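(* Consider the isentropic relativistic Euler equations on Minkowski spacetime, $$\frac{\partial}{\partial x^\alpha}(n u^\alpha)=0,\qquad (\rho+p)u^\alpha\frac{\partial u^\mu}{\partial x^\alpha}+(u^\mu u^\alpha+g^{\mu\alpha})\frac{\partial p}{\partial x^\alpha}=0\ (\mu=0,1,2,3),\qquad g_{\alpha\beta}u^\alpha u^\beta=-1,$$ with the equation of state $p(\rho)=\rho^2$ (for which $\rho=n/(1-n)$). Relative to the Lagrangian coordinates $(\tau,y^1,y^2,y^3)$ and in terms of the Lagrangian unknowns $f=n\circ\eta$, $v^\mu=u^\mu\circ\eta$, $S=s\circ\eta=(1-f)^{-2}$, these equations can be expressed as the following system in the components $\{\eta^\alpha\}_{\alpha=0,1,2,3}$ of the flow map: $$f\mathscr J=\mathring F,$$ $$\mathring F S\,\partial_\tau v_\mu+\partial_K\big\{\mathring F^2\mathscr A^K_\mu\mathscr J^{-1}S\big\}-2\mathring F^2v_\mu\mathscr J^{-2}S^{3/2}\partial_\tau\mathscr J=0,\qquad(\ast)$$ $$g_{\alpha\beta}v^\alpha v^\beta=-1,$$ where $\mathring F:=\mathring n\,\mathring v^0$ and $v^0=\sqrt{1+\sum_{a=1}^3(v^a)^2}$. Moreover, $(\ast)$ can be written in the following two equivalent forms: $$\partial_\tau(Sv_\mu)+\mathscr A^K_\mu\partial_KS=0,$$ and $$\begin{aligned}\mathring F a^3_\mu\partial_3(\mathscr J^{-2})+2a^3_\mu(\partial_3\mathring F)\mathscr J^{-2}=&-S^{-1/2}\partial_\tau^2\eta_\mu+2\mathring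 F\mathscr J^{-2}\partial_\tau\mathscr J\,\partial_\tau\eta_\mu-\mathring F a^0_\mu\partial_\tau(\mathscr J^{-2})\\&-\mathring F\sum_{A=1}^2a^A_\mu\partial_A(\mathscr J^{-2})-2\sum_{A=1}^2(a^A_\mu\partial_A\mathring F)\mathscr J^{-2}.\end{aligned}$$
   Context: Conventions. $g=\mathrm{diag}(-1,1,1,1)$ on $\mathbb R^{1+3}$ with rectangular coordinates $x^\alpha$; repeated upper/lower indices are summed; Greek and capital Latin indices run over $0,1,2,3$ (unless a range is displayed); Greek indices are raised and lowered with $g$. Fluid. $n\ge0$ is the proper number density, $\rho$ the proper energy density, $p$ the pressure, $u$ the future-directed ($u^0>0$) four-velocity, $s=(\rho+p)/n$ the enthalpy per particle, with thermodynamic relation $s=d\rho/dn$. For $p=\rho^2$ one has $\rho=n/(1-n)$, $s=(1-n)^{-2}$, and $0\le n<1/3$ (sound speed less than $1$). Initial data at $x^0=0$: $\mathring n=n$, $\mathring v^\mu=u^\mu$. The material manifold $\mathfrak M$ is the closure of the set in $\{x^0=0\}$ where $\mathring n>0$ (here $\mathfrak M=\mathbb T^2\times[0,1]$), with coordinates $(y^1,y^2,y^3)$ induced by the rectangular ones. Lagrangian coordinates. The flow map $\eta$ on $I\times\mathfrak M$ ($I\ni0$ an interval) solves $\partial_\tau\eta^\nu=u^\nu\circ\eta$, $\eta(0,y)=(0,y^1,y^2,y^3)$. Write $y^0=\tau$, $\partial_K=\partial/\partial y^K$, $\partial_0=\partial_\tau$. Set $\mathscr M_K^\nu=\partial_K\eta^\nu$,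 $\mathscr A=\mathscr M^{-1}$ (so $\mathscr M^\alpha_K\mathscr A^L_\alpha=\delta^L_K$), $\mathscr J=\det\mathscr M$, $a^K_\alpha=\mathscr J\mathscr A^K_\alpha$. In particular $v^\mu=\partial_\tau\eta^\mu$ and $\mathscr J|_{\tau=0}=\mathring v^0$. All functions are assumed smooth. *)

theory Defs
  imports "HOL-Analysis.Analysis"
begin

text \<open>
  Spacetime and the Lagrangian coordinate space are both \<^typ>\<open>real^4\<close>. The index type
  \<^typ>\<open>4\<close> has the elements 0, 1, 2, 3 (the numeral 4 denotes the same element as 0), so
  \<open>x $ 0\<close> is the time component. The torus factor in the variables 1, 2 is the quotient of the
  plane by the integer lattice; all functions are given by their lifts to the universal cover.
\<close>

type_synonym R4 = "real^4"

subsection \<open>Smooth functions and partial derivatives on sets with boundary\<close>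

primrec Ck_on :: "nat \<Rightarrow> ('a::euclidean_space \<Rightarrow> 'b::real_normed_vector) \<Rightarrow> 'a set \<Rightarrow> bool" where
  "Ck_on 0 f U \<longleftrightarrow> continuous_on U f"
| "Ck_on (Suc k) f U \<longleftrightarrow>
     (\<forall>x\<in>U. f differentiable (at x)) \<and> (\<forall>w. Ck_on k (\<lambda>x. frechet_derivative f (at x) w) U)"

text \<open>Smooth up to the boundary: restriction of a \<open>C\<^sup>\<infinity>\<close> function on an open neighbourhood.\<close>

definition smooth_upto :: "'a::euclidean_space set \<Rightarrow> ('a \<Rightarrow> 'b::real_normed_vector) \<Rightarrow> bool" where
  "smooth_upto D f \<longleftrightarrow>
     (\<exists>U g. open U \<and> D \<subseteq> U \<and> (\<forall>k. Ck_on k g U) \<and> (\<forall>x\<in>D. g x = f x))"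

text \<open>
  The partial derivative in direction \<open>K\<close>, taken within \<open>D\<close>. It depends only on \<open>f\<close> restricted
  to \<open>D\<close>. For a function smooth up to the boundary of one of the domains below (derivatives within
  \<open>D\<close> are unique there) it is the partial derivative of any smooth extension.
\<close>

definition pd :: "R4 set \<Rightarrow> 4 \<Rightarrow> (R4 \<Rightarrow> real) \<Rightarrow> R4 \<Rightarrow> real" where
  "pd D K f x = frechet_derivative f (at x within D) (axis K 1)"

subsection \<open>Minkowski metric\<close>

definition mink :: "real^4^4" where
  "mink = (\<chi> \<mu> \<nu>. if \<mu> \<noteq> \<nu> then 0 else if \<mu> = 0 then - 1 else 1)"

text \<open>The components with upper and with lower indices agree, so \<^const>\<open>mink\<close> is used for both.\<close>

lemma mink_self_inverse: "mink ** mink = mat 1"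
proof -
  define c :: "4 \<Rightarrow> real" where "c = (\<lambda>i. if i = 0 then - 1 else 1)"
  have "(\<Sum>k\<in>UNIV. mink $ i $ k * mink $ k $ j) = (if i = j then 1 else 0)" for i j
  proof -
    have "(\<Sum>k\<in>UNIV. mink $ i $ k * mink $ k $ j) =
        (\<Sum>k\<in>UNIV. if k = i then c i * mink $ i $ j else 0)"
      by (intro sum.cong refl) (auto simp: mink_def c_def)
    also have "\<dots> = c i * mink $ i $ j"
      by (subst sum.delta) auto
    also have "\<dots> = (if i = j then 1 else 0)"
      by (auto simp: mink_def c_def)
    finally show ?thesis .
  qed
  then show ?thesis
    by (simp add: matrix_matrix_mult_def mat_def vec_eq_iff)
qed

definition lower :: "R4 \<Rightarrow> 4 \<Rightarrow> real" where
  "lower v \<mu> = (\<Sum>\<nu>\<in>UNIV. mink $ \<mu> $ \<nu> * v $ \<nu>)"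

definition mink_prod :: "R4 \<Rightarrow> R4 \<Rightarrow> real" where
  "mink_prod v w = (\<Sum>\<alpha>\<in>UNIV. \<Sum>\<beta>\<in>UNIV. mink $ \<alpha> $ \<beta> * v $ \<alpha> * w $ \<beta>)"

subsection \<open>Equation of state and the relativistic Euler equations\<close>

definition pressure :: "real \<Rightarrow> real" where
  "pressure \<rho> = \<rho>\<^sup>2"

definition energy :: "real \<Rightarrow> real" where
  "energy n = n / (1 - n)"

text \<open>In closed form, since the quotient \<open>(\<rho> + p) / n\<close> is undefined at the vacuum boundary \<open>n = 0\<close>.\<close>

definition enthalpy :: "real \<Rightarrow> real" where
  "enthalpy n = (1 - n) powi (-2)"

lemma enthalpy_eq:
  assumes "0 < n" "n < 1"
  shows "enthalpy n = (energy n + pressure (energy n)) / n"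
  using assms
  by (simp add: enthalpy_def energy_def pressure_def power_int_minus power2_eq_square divide_simps)
     (simp add: algebra_simps)

lemma enthalpy_deriv:
  assumes "n < 1"
  shows "(energy has_real_derivative enthalpy n) (at n)"
proof -
  have "((\<lambda>n. n / (1 - n)) has_real_derivative enthalpy n) (at n)"
    using assms
    by (auto intro!: derivative_eq_intros
        simp: enthalpy_def power_int_minus power2_eq_square divide_simps)
  then show ?thesis
    by (simp add: energy_def[abs_def])
qed

definition euler_equations :: "R4 set \<Rightarrow> (R4 \<Rightarrow> real) \<Rightarrow> (R4 \<Rightarrow> R4) \<Rightarrow> bool" where
  "euler_equations D n u \<longleftrightarrow>
     (let \<rho> = (\<lambda>x. energy (n x)); p = (\<lambda>x. pressure (\<rho> x)) in
      \<forall>x\<in>D.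
        (\<Sum>\<alpha>\<in>UNIV. pd D \<alpha> (\<lambda>x. n x * u x $ \<alpha>) x) = 0 \<and>
        (\<forall>\<mu>. (\<rho> x + p x) * (\<Sum>\<alpha>\<in>UNIV. u x $ \<alpha> * pd D \<alpha> (\<lambda>x. u x $ \<mu>) x)
              + (\<Sum>\<alpha>\<in>UNIV. (u x $ \<mu> * u x $ \<alpha> + mink $ \<mu> $ \<alpha>) * pd D \<alpha> p x) = 0) \<and>
        mink_prod (u x) (u x) = - 1)"

subsection \<open>Lagrangian coordinates\<close>

definition material :: "R4 set" where
  "material = {y. y $ 0 = 0 \<and> 0 \<le> y $ 3 \<and> y $ 3 \<le> 1}"

definition lagr_domain :: "real set \<Rightarrow> R4 set" where
  "lagr_domain I = {y. y $ 0 \<in> I \<and> 0 \<le> y $ 3 \<and> y $ 3 \<le> 1}"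

text \<open>The point of \<^const>\<open>material\<close> with the same label; used to read off the initial data.\<close>

definition init_pt :: "R4 \<Rightarrow> R4" where
  "init_pt y = (\<chi> K. if K = 0 then 0 else y $ K)"

text \<open>
  The third clause says that \<open>\<eta>\<close> is the lift of a map from \<open>I\<close> times the material manifold into
  spacetime with the variables 1, 2 taken modulo 1.
\<close>

definition flow_map :: "real set \<Rightarrow> (R4 \<Rightarrow> R4) \<Rightarrow> (R4 \<Rightarrow> R4) \<Rightarrow> bool" where
  "flow_map I u \<eta> \<longleftrightarrow>
     (\<forall>y\<in>lagr_domain I. \<forall>\<nu>. pd (lagr_domain I) 0 (\<lambda>y. \<eta> y $ \<nu>) y = u (\<eta> y) $ \<nu>) \<and>
     (\<forall>y\<in>material. \<eta> y = y) \<and>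
     (\<forall>y\<in>lagr_domain I. \<forall>A\<in>{1, 2}. \<eta> (y + axis A 1) = \<eta> y + axis A 1)"

definition fluid_region :: "real set \<Rightarrow> (R4 \<Rightarrow> R4) \<Rightarrow> R4 set" where
  "fluid_region I \<eta> = \<eta> ` lagr_domain I"

definition torus_periodic :: "R4 set \<Rightarrow> (R4 \<Rightarrow> 'b) \<Rightarrow> bool" where
  "torus_periodic D \<phi> \<longleftrightarrow> (\<forall>x\<in>D. \<forall>A\<in>{1, 2}. \<phi> (x + axis A 1) = \<phi> x)"

text \<open>\<open>M $ \<nu> $ K\<close> is the derivative of \<open>\<eta>\<^sup>\<nu>\<close> in \<open>y\<^sup>K\<close>, and \<open>A $ K $ \<alpha>\<close>, \<open>a $ K $ \<alpha>\<close> have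
  the material index first.\<close>

definition Mmat :: "R4 set \<Rightarrow> (R4 \<Rightarrow> R4) \<Rightarrow> R4 \<Rightarrow> real^4^4" where
  "Mmat \<Omega> \<eta> y = (\<chi> \<nu> K. pd \<Omega> K (\<lambda>y. \<eta> y $ \<nu>) y)"

definition Amat :: "R4 set \<Rightarrow> (R4 \<Rightarrow> R4) \<Rightarrow> R4 \<Rightarrow> real^4^4" where
  "Amat \<Omega> \<eta> y = matrix_inv (Mmat \<Omega> \<eta> y)"

definition Jdet :: "R4 set \<Rightarrow> (R4 \<Rightarrow> R4) \<Rightarrow> R4 \<Rightarrow> real" where
  "Jdet \<Omega> \<eta> y = det (Mmat \<Omega> \<eta> y)"

definition amat :: "R4 set \<Rightarrow> (R4 \<Rightarrow> R4) \<Rightarrow> R4 \<Rightarrow> real^4^4" where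
  "amat \<Omega> \<eta> y = Jdet \<Omega> \<eta> y *\<^sub>R Amat \<Omega> \<eta> y"

subsection \<open>The Lagrangian form of the equations\<close>

definition mass_eq ::
  "R4 set \<Rightarrow> (R4 \<Rightarrow> R4) \<Rightarrow> (R4 \<Rightarrow> real) \<Rightarrow> (R4 \<Rightarrow> real) \<Rightarrow> bool" where
  "mass_eq \<Omega> \<eta> F f \<longleftrightarrow> (\<forall>y\<in>\<Omega>. f y * Jdet \<Omega> \<eta> y = F y)"

definition momentum_eq ::
  "R4 set \<Rightarrow> (R4 \<Rightarrow> R4) \<Rightarrow> (R4 \<Rightarrow> real) \<Rightarrow> (R4 \<Rightarrow> real) \<Rightarrow> (R4 \<Rightarrow> R4) \<Rightarrow> 4 \<Rightarrow> bool" where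
  "momentum_eq \<Omega> \<eta> F S v \<mu> \<longleftrightarrow>
     (let A = Amat \<Omega> \<eta>; J = Jdet \<Omega> \<eta> in
      \<forall>y\<in>\<Omega>.
        F y * S y * pd \<Omega> 0 (\<lambda>y. lower (v y) \<mu>) y
        + (\<Sum>K\<in>UNIV. pd \<Omega> K (\<lambda>y. (F y)\<^sup>2 * A y $ K $ \<mu> * J y powi (-1) * S y) y)
        - 2 * (F y)\<^sup>2 * lower (v y) \<mu> * J y powi (-2) * S y powr (3/2) * pd \<Omega> 0 J y = 0)"

definition momentum_eq_Sv_form ::
  "R4 set \<Rightarrow> (R4 \<Rightarrow> R4) \<Rightarrow> (R4 \<Rightarrow> real) \<Rightarrow> (R4 \<Rightarrow> R4) \<Rightarrow> 4 \<Rightarrow> bool" where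
  "momentum_eq_Sv_form \<Omega> \<eta> S v \<mu> \<longleftrightarrow>
     (\<forall>y\<in>\<Omega>. pd \<Omega> 0 (\<lambda>y. S y * lower (v y) \<mu>) y
            + (\<Sum>K\<in>UNIV. Amat \<Omega> \<eta> y $ K $ \<mu> * pd \<Omega> K S y) = 0)"

definition momentum_eq_normal_form ::
  "R4 set \<Rightarrow> (R4 \<Rightarrow> R4) \<Rightarrow> (R4 \<Rightarrow> real) \<Rightarrow> (R4 \<Rightarrow> real) \<Rightarrow> 4 \<Rightarrow> bool" where
  "momentum_eq_normal_form \<Omega> \<eta> F S \<mu> \<longleftrightarrow>
     (let a = amat \<Omega> \<eta>; J = Jdet \<Omega> \<eta>; J2 = (\<lambda>y. J y powi (-2));
          \<eta>\<^sub>l = (\<lambda>y. lower (\<eta> y) \<mu>) in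
      \<forall>y\<in>\<Omega>.
        F y * a y $ 3 $ \<mu> * pd \<Omega> 3 J2 y + 2 * a y $ 3 $ \<mu> * pd \<Omega> 3 F y * J2 y =
        - (S y powr (-1/2)) * pd \<Omega> 0 (pd \<Omega> 0 \<eta>\<^sub>l) y
        + 2 * F y * J2 y * pd \<Omega> 0 J y * pd \<Omega> 0 \<eta>\<^sub>l y
        - F y * a y $ 0 $ \<mu> * pd \<Omega> 0 J2 y
        - F y * (\<Sum>A\<in>{1, 2}. a y $ A $ \<mu> * pd \<Omega> A J2 y)
        - 2 * (\<Sum>A\<in>{1, 2}. a y $ A $ \<mu> * pd \<Omega> A F y) * J2 y)"

definition normalization_eq :: "R4 set \<Rightarrow> (R4 \<Rightarrow> R4) \<Rightarrow> bool" where
  "normalization_eq \<Omega> v \<longleftrightarrow>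
     (\<forall>y\<in>\<Omega>. mink_prod (v y) (v y) = - 1 \<and> v y $ 0 = sqrt (1 + (\<Sum>a\<in>{1, 2, 3}. (v y $ a)\<^sup>2)))"

end

theory Submission
  imports Defs
begin

text \<open>
  Everything is measured against one quantity, the momentum defect
  \<open>E\<^sub>\<mu> = S \<partial>\<^sub>\<tau> v\<^sub>\<mu> + v\<^sub>\<mu> \<partial>\<^sub>\<tau> S + A\<^sup>K\<^sub>\<mu> \<partial>\<^sub>K S\<close>, the left-hand side of the second form of the
  momentum equation. For this equation of state \<open>\<rho> + p = n s\<close> and \<open>dp = n ds\<close>, and a spacetime
  derivative becomes \<open>A\<^sup>K\<^sub>\<alpha> \<partial>\<^sub>K\<close> along the flow map. Hence the residuals of the competing equations
  are multiples of \<open>E\<^sub>\<mu>\<close>: the residual of the Euler momentum equation at \<open>\<eta> y\<close>, with its index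
  lowered, is \<open>f E\<^sub>\<mu>\<close> (\<open>euler_momentum_residual\<close>); once mass is conserved, the residual of the
  divergence form is \<open>F E\<^sub>\<mu>\<close> (\<open>momentum_residual\<close>, where the Piola identity \<open>\<partial>\<^sub>K (J A\<^sup>K\<^sub>\<mu>) = 0\<close> pulls the
  cofactor matrix out of the divergence), and the residual of the form solved for the derivative in
  \<open>y\<^sup>3\<close> is \<open>S\<close> to the power \<open>-3/2\<close> times \<open>E\<^sub>\<mu>\<close> (\<open>normal_residual\<close>).

  The factors \<open>f\<close> and \<open>F\<close> vanish at the vacuum boundary, so there the Euler and divergence forms carry no
  information by themselves. But \<open>E\<^sub>\<mu>\<close> is continuous, and the labels with \<open>F > 0\<close> are dense because the
  material manifold is the closure of the set of positive initial density; so \<open>F E\<^sub>\<mu> = 0\<close> forces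
  \<open>E\<^sub>\<mu> = 0\<close> (\<open>zero_off_vacuum_imp_zero\<close>).

  Conservation of mass is Jacobi's formula. The mixed second derivatives of \<open>\<eta>\<close> commute, so
  \<open>\<partial>\<^sub>\<tau> M = (Du \<circ> \<eta>) M\<close> and \<open>\<partial>\<^sub>\<tau> J = (div u \<circ> \<eta>) J\<close>. This linear equation with \<open>J = u\<^sup>0 > 0\<close> initially gives
  \<open>J > 0\<close> throughout (\<open>J_pos\<close>), and it gives \<open>\<partial>\<^sub>\<tau> (f J) = (div (n u) \<circ> \<eta>) J\<close>, so that
  \<open>div (n u) = 0\<close> says exactly that \<open>f J\<close> keeps its initial value \<open>F\<close> (\<open>mass_eq_iff\<close>).

  The positivity of \<open>J\<close> has a second use. The fluid region is only known as the image of \<open>\<eta>\<close>, and a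
  derivative within it is meaningful because \<open>M\<close>, being invertible, carries the uniqueness of
  derivatives within the Lagrangian domain over to the image (\<open>unique_derivs_D\<close>).
\<close>

section \<open>Second derivatives of smooth functions up to the boundary\<close>

text \<open>
  The mean value theorem, once in each direction, turns the second difference over a parallelogram
  into a mixed second derivative at some point of it. The difference is symmetric in the two
  directions while the derivative is not visibly so, which is what proves the symmetry below.
\<close>

lemma mixed_difference:
  fixes g :: "'a::real_normed_vector \<Rightarrow> real"
  assumes "0 < h"
    and mem: "\<And>s t. 0 \<le> s \<Longrightarrow> s \<le> h \<Longrightarrow> 0 \<le> t \<Longrightarrow> t \<le> h \<Longrightarrow> x + s *\<^sub>R a + t *\<^sub>R b \<in> U"
    and g': "\<And>z. z \<in> U \<Longrightarrow> (g has_derivative g' z) (at z)"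
    and g'': "\<And>z. z \<in> U \<Longrightarrow> ((\<lambda>z. g' z a) has_derivative g'' z) (at z)"
  obtains s t where "0 \<le> s" "s \<le> h" "0 \<le> t" "t \<le> h"
    "g (x + h *\<^sub>R a + h *\<^sub>R b) - g (x + h *\<^sub>R a) - g (x + h *\<^sub>R b) + g x
      = h\<^sup>2 * g'' (x + s *\<^sub>R a + t *\<^sub>R b) b"
proof -
  have dg: "((\<lambda>s. g (x + s *\<^sub>R a + t *\<^sub>R b)) has_real_derivative g' (x + s *\<^sub>R a + t *\<^sub>R b) a) (at s)"
    if "0 \<le> s" "s \<le> h" "0 \<le> t" "t \<le> h" for s t
  proof -
    interpret L: bounded_linear "g' (x + s *\<^sub>R a + t *\<^sub>R b)"
      using g'[OF mem[OF that]] by (rule has_derivative_bounded_linear)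
    have "((\<lambda>s. g (x + s *\<^sub>R a + t *\<^sub>R b)) has_derivative
        (\<lambda>r. g' (x + s *\<^sub>R a + t *\<^sub>R b) (r *\<^sub>R a))) (at s)"
      by (rule has_derivative_compose[where f = "\<lambda>s. x + s *\<^sub>R a + t *\<^sub>R b" and g = g, OF _ g'[OF mem[OF that]]]) (auto intro!: derivative_eq_intros)
    then show ?thesis
      by (simp add: has_field_derivative_def L.scaleR mult.commute[of _ "g' _ a"])
  qed
  have dg': "((\<lambda>t. g' (x + s *\<^sub>R a + t *\<^sub>R b) a) has_real_derivative g'' (x + s *\<^sub>R a + t *\<^sub>R b) b) (at t)"
    if "0 \<le> s" "s \<le> h" "0 \<le> t" "t \<le> h" for s t
  proof -
    interpret L: bounded_linear "g'' (x + s *\<^sub>R a + t *\<^sub>R b)"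
      using g''[OF mem[OF that]] by (rule has_derivative_bounded_linear)
    have "((\<lambda>t. g' (x + s *\<^sub>R a + t *\<^sub>R b) a) has_derivative
        (\<lambda>r. g'' (x + s *\<^sub>R a + t *\<^sub>R b) (r *\<^sub>R b))) (at t)"
      by (rule has_derivative_compose[where f = "\<lambda>t. x + s *\<^sub>R a + t *\<^sub>R b" and g = "\<lambda>z. g' z a", OF _ g''[OF mem[OF that]]]) (auto intro!: derivative_eq_intros)
    then show ?thesis
      by (simp add: has_field_derivative_def L.scaleR mult.commute[of _ "g'' _ b"])
  qed
  have "((\<lambda>s. g (x + s *\<^sub>R a + h *\<^sub>R b) - g (x + s *\<^sub>R a + 0 *\<^sub>R b)) has_real_derivative
      g' (x + s *\<^sub>R a + h *\<^sub>R b) a - g' (x + s *\<^sub>R a + 0 *\<^sub>R b) a) (at s)"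
    if "0 \<le> s" "s \<le> h" for s
    using that \<open>0 < h\<close> by (intro DERIV_diff dg) auto
  from MVT2[OF \<open>0 < h\<close> this] obtain s where s: "0 < s" "s < h" and s_eq:
    "(g (x + h *\<^sub>R a + h *\<^sub>R b) - g (x + h *\<^sub>R a + 0 *\<^sub>R b)) - (g (x + 0 *\<^sub>R a + h *\<^sub>R b) - g (x + 0 *\<^sub>R a + 0 *\<^sub>R b))
      = (h - 0) * (g' (x + s *\<^sub>R a + h *\<^sub>R b) a - g' (x + s *\<^sub>R a + 0 *\<^sub>R b) a)"
    by blast
  have "((\<lambda>t. g' (x + s *\<^sub>R a + t *\<^sub>R b) a) has_real_derivative g'' (x + s *\<^sub>R a + t *\<^sub>R b) b) (at t)"
    if "0 \<le> t" "t \<le> h" for t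
    using that s by (intro dg') auto
  from MVT2[OF \<open>0 < h\<close> this] obtain t where t: "0 < t" "t < h" and t_eq:
    "g' (x + s *\<^sub>R a + h *\<^sub>R b) a - g' (x + s *\<^sub>R a + 0 *\<^sub>R b) a = (h - 0) * g'' (x + s *\<^sub>R a + t *\<^sub>R b) b"
    by blast
  show thesis
  proof (rule that[of s t])
    show "g (x + h *\<^sub>R a + h *\<^sub>R b) - g (x + h *\<^sub>R a) - g (x + h *\<^sub>R b) + g x
        = h\<^sup>2 * g'' (x + s *\<^sub>R a + t *\<^sub>R b) b"
      using s_eq unfolding t_eq by (simp add: power2_eq_square)
  qed (use s t in auto)
qed

lemma mixed_second_derivatives_eq:
  fixes g :: "'a::real_normed_vector \<Rightarrow> real"
  assumes U: "open U" "x \<in> U"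
    and g': "\<And>z. z \<in> U \<Longrightarrow> (g has_derivative g' z) (at z)"
    and g'': "\<And>z w. z \<in> U \<Longrightarrow> ((\<lambda>z. g' z w) has_derivative g'' w z) (at z)"
    and cont: "\<And>w w'. continuous_on U (\<lambda>z. g'' w z w')"
  shows "g'' a x b = g'' b x a"
proof (rule ccontr)
  assume neq: "g'' a x b \<noteq> g'' b x a"
  define e where "e = \<bar>g'' a x b - g'' b x a\<bar> / 2"
  have "e > 0"
    using neq by (simp add: e_def)
  obtain r where r: "r > 0" "ball x r \<subseteq> U"
    using U openE by blast
  have "isCont (\<lambda>z. g'' a z b) x" "isCont (\<lambda>z. g'' b z a) x"
    using cont U continuous_on_eq_continuous_at by blast+
  then obtain d1 d2 where d: "d1 > 0" "d2 > 0"
    "\<And>z. dist z x < d1 \<Longrightarrow> dist (g'' a z b) (g'' a x b) < e"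
    "\<And>z. dist z x < d2 \<Longrightarrow> dist (g'' b z a) (g'' b x a) < e"
    using \<open>e > 0\<close> unfolding continuous_at_eps_delta by metis
  define m where "m = min r (min d1 d2)"
  \<comment> \<open>the parallelogram of side \<open>h\<close> stays within distance \<open>m\<close> of \<open>x\<close>; the \<open>1\<close> covers \<open>a = b = 0\<close>\<close>
  define h where "h = m / (2 * (norm a + norm b + 1))"
  have "m > 0"
    using r d by (simp add: m_def)
  have N: "norm a + norm b + 1 > 0"
    by (smt (verit) norm_ge_zero)
  then have "h > 0"
    using \<open>m > 0\<close> by (simp add: h_def)
  have small: "dist (x + s *\<^sub>R a + t *\<^sub>R b) x < m" if "0 \<le> s" "s \<le> h" "0 \<le> t" "t \<le> h" for s t
  proof -
    have "dist (x + s *\<^sub>R a + t *\<^sub>R b) x = norm (s *\<^sub>R a + t *\<^sub>R b)"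
      by (simp add: dist_norm add.assoc)
    also have "\<dots> \<le> s * norm a + t * norm b"
      using that norm_triangle_ineq[of "s *\<^sub>R a" "t *\<^sub>R b"] by simp
    also have "\<dots> \<le> h * norm a + h * norm b"
      using that by (intro add_mono mult_right_mono) auto
    also have "\<dots> \<le> h * (norm a + norm b + 1)"
      using \<open>h > 0\<close> by (simp add: algebra_simps)
    also have "\<dots> = m / 2"
      using N by (simp add: h_def del: distrib_left_numeral)
    also have "\<dots> < m"
      using \<open>m > 0\<close> by simp
    finally show ?thesis .
  qed
  have mem: "x + s *\<^sub>R a + t *\<^sub>R b \<in> U" if "0 \<le> s" "s \<le> h" "0 \<le> t" "t \<le> h" for s t
    using small[OF that] r by (auto simp: m_def dist_commute)
  have mem': "x + s *\<^sub>R b + t *\<^sub>R a \<in> U" if "0 \<le> s" "s \<le> h" "0 \<le> t" "t \<le> h" for s t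
    using mem[of t s] that by (simp add: ac_simps)
  obtain s t where st: "0 \<le> s" "s \<le> h" "0 \<le> t" "t \<le> h"
    "g (x + h *\<^sub>R a + h *\<^sub>R b) - g (x + h *\<^sub>R a) - g (x + h *\<^sub>R b) + g x
      = h\<^sup>2 * g'' a (x + s *\<^sub>R a + t *\<^sub>R b) b"
    using mixed_difference[OF \<open>h > 0\<close> mem g' g''] by blast
  obtain s' t' where st': "0 \<le> s'" "s' \<le> h" "0 \<le> t'" "t' \<le> h"
    "g (x + h *\<^sub>R b + h *\<^sub>R a) - g (x + h *\<^sub>R b) - g (x + h *\<^sub>R a) + g x
      = h\<^sup>2 * g'' b (x + s' *\<^sub>R b + t' *\<^sub>R a) a"
    using mixed_difference[OF \<open>h > 0\<close> mem' g' g''] by blast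
  have "x + h *\<^sub>R b + h *\<^sub>R a = x + h *\<^sub>R a + h *\<^sub>R b"
    by (simp add: ac_simps)
  with st(5) st'(5) have "h\<^sup>2 * g'' a (x + s *\<^sub>R a + t *\<^sub>R b) b = h\<^sup>2 * g'' b (x + s' *\<^sub>R b + t' *\<^sub>R a) a"
    by (simp only:)
  then have "g'' a (x + s *\<^sub>R a + t *\<^sub>R b) b = g'' b (x + t' *\<^sub>R a + s' *\<^sub>R b) a"
    using \<open>h > 0\<close> by (simp add: ac_simps)
  moreover have "dist (g'' a (x + s *\<^sub>R a + t *\<^sub>R b) b) (g'' a x b) < e"
    using small[of s t] st d by (auto simp: m_def)
  moreover have "dist (g'' b (x + t' *\<^sub>R a + s' *\<^sub>R b) a) (g'' b x a) < e"
    using small[of t' s'] st' d by (auto simp: m_def)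
  ultimately have "dist (g'' a x b) (g'' b x a) < e + e"
    by (smt (verit) dist_commute dist_triangle)
  then show False
    by (simp add: e_def dist_real_def)
qed

lemma smooth_upto_C1:
  assumes "smooth_upto D h"
  obtains h' where "\<And>x. x \<in> D \<Longrightarrow> (h has_derivative h' x) (at x within D)"
    "\<And>w. continuous_on D (\<lambda>x. h' x w)"
proof -
  obtain U g where U: "open U" "D \<subseteq> U" and Ck: "\<And>k. Ck_on k g U" and eq: "\<And>x. x \<in> D \<Longrightarrow> g x = h x"
    using assms unfolding smooth_upto_def by blast
  show thesis
  proof (rule that[of "\<lambda>x. frechet_derivative g (at x)"])
    show "(h has_derivative frechet_derivative g (at x)) (at x within D)" if "x \<in> D" for x
    proof -
      have "(g has_derivative frechet_derivative g (at x)) (at x)"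
        using Ck[of "Suc 0"] U that by (auto simp: frechet_derivative_works)
      then show ?thesis
        by (metis eq has_derivative_at_withinI has_derivative_transform that)
    qed
    show "continuous_on D (\<lambda>x. frechet_derivative g (at x) w)" for w
      using Ck[of "Suc 0"] U by (auto intro: continuous_on_subset)
  qed
qed

text \<open>
  The symmetry holds for a smooth extension in its open domain; only its restriction to \<open>D\<close> survives
  in the conclusion, including boundary points of \<open>D\<close>.
\<close>

lemma smooth_upto_C2:
  fixes h :: "'a::euclidean_space \<Rightarrow> real^'n"
  assumes "smooth_upto D h"
  obtains h' h'' where "\<And>x. x \<in> D \<Longrightarrow> (h has_derivative h' x) (at x within D)"
    "\<And>x w. x \<in> D \<Longrightarrow> ((\<lambda>x. h' x w) has_derivative h'' w x) (at x within D)"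
    "\<And>x w w'. x \<in> D \<Longrightarrow> h'' w x w' = h'' w' x w"
proof -
  obtain U g where U: "open U" "D \<subseteq> U" and Ck: "\<And>k. Ck_on k g U" and eq: "\<And>x. x \<in> D \<Longrightarrow> g x = h x"
    using assms unfolding smooth_upto_def by blast
  define g' where "g' = (\<lambda>x. frechet_derivative g (at x))"
  define g'' where "g'' = (\<lambda>w x. frechet_derivative (\<lambda>x. g' x w) (at x))"
  have g': "(g has_derivative g' x) (at x)" if "x \<in> U" for x
    using Ck[of "Suc 0"] U that by (auto simp: frechet_derivative_works g'_def)
  have g'': "((\<lambda>x. g' x w) has_derivative g'' w x) (at x)" if "x \<in> U" for x w
    using Ck[of "Suc (Suc 0)"] U that by (auto simp: frechet_derivative_works g'_def g''_def)
  have cont: "continuous_on U (\<lambda>x. g'' w x w')" for w w'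
    using Ck[of "Suc (Suc 0)"] by (auto simp: g'_def g''_def)
  have sym: "g'' w x w' = g'' w' x w" if "x \<in> U" for x w w'
  proof -
    have "g'' w x w' $ i = g'' w' x w $ i" for i
      by (rule mixed_second_derivatives_eq[OF U(1) that, of "\<lambda>x. g x $ i" "\<lambda>x h. g' x h $ i"])
        (auto intro!: bounded_linear.has_derivative[OF bounded_linear_vec_nth] g' g'' continuous_intros cont)
    then show ?thesis
      by (simp add: vec_eq_iff)
  qed
  show thesis
  proof (rule that[of g' g''])
    show "(h has_derivative g' x) (at x within D)" if "x \<in> D" for x
      by (metis U(2) eq g' has_derivative_at_withinI has_derivative_transform subsetD that)
    show "((\<lambda>x. g' x w) has_derivative g'' w x) (at x within D)" if "x \<in> D" for x w
      using g'' U(2) that by (blast intro: has_derivative_at_withinI)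
    show "g'' w x w' = g'' w' x w" if "x \<in> D" for x w w'
      using sym U(2) that by blast
  qed
qed

section \<open>Scalar linear differential equations\<close>

text \<open>
  The integrating factor \<open>exp (- \<integral> c)\<close> makes \<open>j\<close> constant along the solution; the time \<open>t\<close> may lie on
  either side of \<open>t0\<close>.
\<close>

lemma linear_ode_pos:
  fixes j c :: "real \<Rightarrow> real"
  assumes I: "is_interval I" "t0 \<in> I" "t \<in> I"
    and j: "\<And>s. s \<in> I \<Longrightarrow> (j has_real_derivative c s * j s) (at s within I)"
    and c: "continuous_on I c" and "j t0 > 0"
  shows "j t > 0"
proof -
  define a b where "a = min t0 t" and "b = max t0 t"
  have ab: "{a..b} \<subseteq> I"
  proof
    fix s assume "s \<in> {a..b}"
    moreover have "a \<in> I" "b \<in> I"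
      using I by (simp_all add: a_def b_def min_def max_def)
    ultimately show "s \<in> I"
      using mem_is_interval_1_I[OF I(1), of a b s] by simp
  qed
  define C where "C = (\<lambda>s. integral {a..s} c)"
  define k where "k = (\<lambda>s. j s * exp (- C s))"
  have C: "(C has_real_derivative c s) (at s within {a..b})" if "s \<in> {a..b}" for s
    unfolding C_def by (rule integral_has_real_derivative[OF continuous_on_subset[OF c ab] that])
  have k: "(k has_real_derivative 0) (at s within {a..b})" if "s \<in> {a..b}" for s
  proof -
    have "(j has_real_derivative c s * j s) (at s within {a..b})"
      using ab that by (blast intro: DERIV_subset j)
    then show ?thesis
      unfolding k_def using C[OF that] by (auto intro!: derivative_eq_intros simp: algebra_simps)
  qed
  obtain r where "\<And>s. s \<in> {a..b} \<Longrightarrow> k s = r"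
    using has_field_derivative_zero_constant[OF convex_real_interval(5) k] by blast
  then have "k t = k t0"
    by (simp add: a_def b_def)
  moreover have "k t0 > 0"
    using \<open>j t0 > 0\<close> by (simp add: k_def)
  ultimately have "k t > 0"
    by simp
  then show ?thesis
    by (simp add: k_def zero_less_mult_iff)
qed

section \<open>Partial derivatives within a set\<close>

text \<open>
  The partial derivatives of \<^const>\<open>pd\<close> come from a choice among all derivatives within a set, so
  the usual rules hold exactly where that choice is forced.
\<close>

definition unique_derivs :: "R4 set \<Rightarrow> R4 \<Rightarrow> bool" where
  "unique_derivs D x \<longleftrightarrow> (\<forall>(h :: R4 \<Rightarrow> real) L L'. (h has_derivative L) (at x within D) \<longrightarrow>
     (h has_derivative L') (at x within D) \<longrightarrow> L = L')"

text \<open>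
  It is enough to be able to leave \<open>x\<close> a little way along each coordinate axis, to one side; in a convex
  set a single further point of the set on each axis through \<open>x\<close> provides this.
\<close>

lemma unique_derivs_convex:
  assumes "convex D" "x \<in> D" and dir: "\<And>K. \<exists>q. q \<noteq> 0 \<and> x + q *\<^sub>R axis K 1 \<in> D"
  shows "unique_derivs D x"
  unfolding unique_derivs_def
proof (intro allI impI)
  fix h :: "R4 \<Rightarrow> real" and L L'
  assume "(h has_derivative L) (at x within D)" "(h has_derivative L') (at x within D)"
  then show "L = L'"
  proof (rule frechet_derivative_unique_within)
    fix i :: R4 and e :: real
    assume "i \<in> Basis" "0 < e"
    then obtain K where i: "i = axis K 1"
      by (auto simp: Basis_vec_def)
    obtain q where q: "q \<noteq> 0" "x + q *\<^sub>R i \<in> D"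
      using dir[of K] i by blast
    define t where "t = min 1 (e / (2 * \<bar>q\<bar>))"
    have t: "0 < t" "t \<le> 1"
      using \<open>0 < e\<close> q by (auto simp: t_def)
    have "t * \<bar>q\<bar> \<le> e / (2 * \<bar>q\<bar>) * \<bar>q\<bar>"
      unfolding t_def by (intro mult_right_mono) auto
    also have "\<dots> < e"
      using q \<open>0 < e\<close> by simp
    finally have "\<bar>t * q\<bar> < e"
      using t by (simp add: abs_mult)
    moreover have "x + (t * q) *\<^sub>R i = (1 - t) *\<^sub>R x + t *\<^sub>R (x + q *\<^sub>R i)"
      by (simp add: algebra_simps)
    then have "x + (t * q) *\<^sub>R i \<in> D"
      using convexD_alt[OF \<open>convex D\<close> \<open>x \<in> D\<close> q(2), of t] t by simp
    ultimately show "\<exists>d. 0 < \<bar>d\<bar> \<and> \<bar>d\<bar> < e \<and> x + d *\<^sub>R i \<in> D"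
      using q t by (intro exI[of _ "t * q"]) auto
  qed
qed

lemma pd_eq:
  assumes "unique_derivs D x" "(h has_derivative L) (at x within D)"
  shows "pd D K h x = L (axis K 1)"
proof -
  have "(h has_derivative frechet_derivative h (at x within D)) (at x within D)"
    using differentiableI[OF assms(2)] by (simp add: frechet_derivative_works)
  then have "frechet_derivative h (at x within D) = L"
    using assms unfolding unique_derivs_def by blast
  then show ?thesis
    by (simp add: pd_def)
qed

lemma pd_cong:
  assumes "x \<in> D" "\<And>z. z \<in> D \<Longrightarrow> g z = h z"
  shows "pd D K g x = pd D K h x"
proof -
  have "(g has_derivative L) (at x within D) \<longleftrightarrow> (h has_derivative L) (at x within D)" for L
    using assms has_derivative_transform by metis
  then show ?thesis
    by (simp add: pd_def frechet_derivative_def)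
qed

context
  fixes D :: "R4 set" and x :: R4
  assumes uniq: "unique_derivs D x"
begin

lemma pd_const: "pd D K (\<lambda>z. c) x = 0"
  by (rule pd_eq[OF uniq has_derivative_const])

lemma pd_mult:
  assumes "g differentiable (at x within D)" "h differentiable (at x within D)"
  shows "pd D K (\<lambda>z. g z * h z) x = pd D K g x * h x + g x * pd D K h x"
  using pd_eq[OF uniq has_derivative_mult, of g _ h] assms
  by (simp add: frechet_derivative_works pd_def)

lemma pd_sum:
  assumes "\<And>i. i \<in> T \<Longrightarrow> g i differentiable (at x within D)"
  shows "pd D K (\<lambda>z. \<Sum>i\<in>T. g i z) x = (\<Sum>i\<in>T. pd D K (g i) x)"
  using pd_eq[OF uniq has_derivative_sum[where f' = "\<lambda>i. frechet_derivative (g i) (at x within D)"], of T g] assms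
  by (simp add: frechet_derivative_works pd_def)

lemma pd_compose_real:
  fixes \<phi> :: "real \<Rightarrow> real"
  assumes "g differentiable (at x within D)" "(\<phi> has_real_derivative d) (at (g x))"
  shows "pd D K (\<lambda>z. \<phi> (g z)) x = d * pd D K g x"
proof -
  have "((\<lambda>z. \<phi> (g z)) has_derivative (\<lambda>h. d * frechet_derivative g (at x within D) h)) (at x within D)"
    using has_derivative_compose[where g = \<phi> and f = g, OF _ assms(2)[unfolded has_field_derivative_def]] assms(1)
    by (simp add: frechet_derivative_works)
  from pd_eq[OF uniq this] show ?thesis
    by (simp add: pd_def)
qed

end

lemma differentiable_compose_real:
  fixes \<phi> :: "real \<Rightarrow> real"
  assumes g: "g differentiable (at x within D)" and \<phi>: "(\<phi> has_real_derivative d) (at (g x))"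
  shows "(\<lambda>z. \<phi> (g z)) differentiable (at x within D)"
proof -
  obtain L where "(g has_derivative L) (at x within D)"
    using g unfolding differentiable_def by blast
  from has_derivative_compose[where g = \<phi>, OF this \<phi>[unfolded has_field_derivative_def]]
  show ?thesis
    by (rule differentiableI)
qed

text \<open>
  Two derivatives on the image pull back to two derivatives of the same function on \<open>S\<close>; they agree
  on the range of \<open>E\<close>, which is everything.
\<close>

lemma unique_derivs_image:
  assumes uniq: "unique_derivs S y"
    and \<eta>: "(\<eta> has_derivative E) (at y within S)" and E: "surj E"
  shows "unique_derivs (\<eta> ` S) (\<eta> y)"
  unfolding unique_derivs_def
proof (intro allI impI)
  fix h :: "R4 \<Rightarrow> real" and L L'
  assume L: "(h has_derivative L) (at (\<eta> y) within \<eta> ` S)"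
    and L': "(h has_derivative L') (at (\<eta> y) within \<eta> ` S)"
  have "(\<lambda>w. L (E w)) = (\<lambda>w. L' (E w))"
    using uniq has_derivative_in_compose[OF \<eta> L] has_derivative_in_compose[OF \<eta> L']
    unfolding unique_derivs_def by blast
  then show "L = L'"
    using E by (metis (full_types) surj_def ext)
qed

section \<open>Derivatives of determinants and inverses, and the Piola identity\<close>

text \<open>
  The derivative of the determinant at \<open>M\<close> in direction \<open>N\<close>, by multilinearity in the rows.
\<close>

definition jac_deriv :: "real^'n^'n \<Rightarrow> real^'n^'n \<Rightarrow> real" where
  "jac_deriv M N = (\<Sum>i\<in>UNIV. det (\<chi> r. if r = i then row i N else row r M))"

text \<open>
  Jacobi's formula in a version valid for singular \<open>M\<close> too: row \<open>i\<close> of \<open>B ** M\<close> is a combination of the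
  rows of \<open>M\<close>, and in the \<open>i\<close>-th summand only the coefficient of row \<open>i\<close> itself survives, as in
  Cramer's rule. The singular case matters because the equation for \<open>J\<close> is what shows that \<open>J\<close>
  does not vanish.
\<close>

lemma jac_deriv_matrix_mult: "jac_deriv M (B ** M) = trace B * det M"
proof -
  have "det (\<chi> r. if r = i then row i (B ** M) else row r M) = B $ i $ i * det M" for i
  proof -
    have eq: "row i (B ** M) = (\<Sum>k\<in>UNIV. (B $ i) $ k *s row k M)"
      by (simp add: row_def matrix_matrix_mult_def vec_eq_iff)
    show ?thesis
      unfolding eq by (rule cramer_lemma_transpose)
  qed
  then show ?thesis
    by (simp add: jac_deriv_def trace_def sum_distrib_right)
qed

lemma has_derivative_det:
  fixes M :: "'a::real_normed_vector \<Rightarrow> real^'n^'n"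
  assumes M: "\<And>i j. ((\<lambda>y. M y $ i $ j) has_derivative (\<lambda>h. M' h $ i $ j)) (at y within S)"
  shows "((\<lambda>y. det (M y)) has_derivative (\<lambda>h. jac_deriv (M y) (M' h))) (at y within S)"
proof -
  have eq: "jac_deriv (M y) (M' h) =
    (\<Sum>p\<in>{p. p permutes UNIV}. of_int (sign p) *
       (\<Sum>i\<in>UNIV. M' h $ i $ p i * (\<Prod>j\<in>UNIV - {i}. M y $ j $ p j)))" for h
  proof -
    have "(\<Prod>j\<in>UNIV. (\<chi> r. if r = i then row i (M' h) else row r (M y)) $ j $ p j) =
      M' h $ i $ p i * (\<Prod>j\<in>UNIV - {i}. M y $ j $ p j)" for i p
      by (subst prod.remove[of UNIV i]) (auto simp: row_def intro!: prod.cong)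
    then show ?thesis
      unfolding jac_deriv_def det_def
      by (subst sum.swap) (simp add: sum_distrib_left)
  qed
  show ?thesis
    unfolding eq det_def
    by (intro has_derivative_sum has_derivative_mult_right has_derivative_prod M)
qed

lemma
  fixes M :: "'a::semiring_1^'n^'n"
  assumes "invertible M"
  shows matrix_inv_left: "matrix_inv M ** M = mat 1"
    and matrix_inv_right: "M ** matrix_inv M = mat 1"
  using someI_ex[OF assms[unfolded invertible_def]] unfolding matrix_inv_def by simp_all

lemma differentiable_det:
  assumes "\<And>i j. (\<lambda>z. M z $ i $ j) differentiable (at x within D)"
  shows "(\<lambda>z. det (M z :: real^'n^'n)) differentiable (at x within D)"
proof -
  have "\<exists>M'. \<forall>i j. ((\<lambda>z. M z $ i $ j) has_derivative M' i j) (at x within D)"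
    using assms unfolding differentiable_def by metis
  then obtain M' where "\<And>i j. ((\<lambda>z. M z $ i $ j) has_derivative M' i j) (at x within D)"
    by blast
  then show ?thesis
    by (intro differentiableI[OF has_derivative_det[where M' = "\<lambda>h. \<chi> i j. M' i j h"]]) simp
qed

lemma pd_det:
  fixes M :: "R4 \<Rightarrow> real^'n^'n"
  assumes uniq: "unique_derivs D x"
    and M: "\<And>i j. (\<lambda>z. M z $ i $ j) differentiable (at x within D)"
    and B: "\<And>i j. pd D K (\<lambda>z. M z $ i $ j) x = (B ** M x) $ i $ j"
  shows "pd D K (\<lambda>z. det (M z)) x = trace B * det (M x)"
proof -
  define M' where "M' = (\<lambda>h. \<chi> i j. frechet_derivative (\<lambda>z. M z $ i $ j) (at x within D) h)"
  have "pd D K (\<lambda>z. det (M z)) x = jac_deriv (M x) (M' (axis K 1))"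
    using M by (intro pd_eq[OF uniq has_derivative_det]) (simp add: M'_def flip: frechet_derivative_works)
  also have "M' (axis K 1) = B ** M x"
    using B by (simp add: M'_def pd_def vec_eq_iff)
  finally show ?thesis
    by (simp add: jac_deriv_matrix_mult)
qed

text \<open>
  Cramer's rule exhibits the entries of the inverse as quotients of determinants, whence their
  differentiability.
\<close>

lemma matrix_inv_cramer:
  fixes M :: "real^'n^'n"
  assumes "det M \<noteq> 0"
  shows "matrix_inv M $ k $ m = det (\<chi> i j. if j = k then axis m 1 $ i else M $ i $ j) / det M"
proof -
  have "invertible M"
    using assms by (simp add: invertible_det_nz)
  then have "M *v (matrix_inv M *v axis m 1) = axis m 1"
    by (simp add: matrix_vector_mul_assoc matrix_inv_right)
  then have "matrix_inv M *v axis m 1 = (\<chi> k. det (\<chi> i j. if j = k then axis m 1 $ i else M $ i $ j) / det M)"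
    using cramer[OF assms] by blast
  then have "(matrix_inv M *v axis m 1) $ k = det (\<chi> i j. if j = k then axis m 1 $ i else M $ i $ j) / det M"
    by simp
  then show ?thesis
    by (simp add: matrix_vector_mul_component inner_axis)
qed

lemma differentiable_matrix_inv:
  fixes M :: "'a::real_normed_vector \<Rightarrow> real^'n^'n"
  assumes x: "x \<in> D" and M: "\<And>i j. (\<lambda>z. M z $ i $ j) differentiable (at x within D)"
    and det: "\<And>z. z \<in> D \<Longrightarrow> det (M z) \<noteq> 0"
  shows "(\<lambda>z. matrix_inv (M z) $ k $ m) differentiable (at x within D)"
proof -
  have "(\<lambda>z. det (\<chi> i j. if j = k then axis m 1 $ i else M z $ i $ j)) differentiable (at x within D)"
  proof (rule differentiable_det)
    show "(\<lambda>z. (\<chi> i j. if j = k then axis m 1 $ i else M z $ i $ j) $ i $ j) differentiable (at x within D)" for i j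
      using M by (cases "j = k") auto
  qed
  then have "(\<lambda>z. det (\<chi> i j. if j = k then axis m 1 $ i else M z $ i $ j) / det (M z))
      differentiable (at x within D)"
    using differentiable_det[OF M] det[OF x] by (intro differentiable_divide) auto
  then obtain L where "((\<lambda>z. det (\<chi> i j. if j = k then axis m 1 $ i else M z $ i $ j) / det (M z))
      has_derivative L) (at x within D)"
    unfolding differentiable_def by blast
  then have "((\<lambda>z. matrix_inv (M z) $ k $ m) has_derivative L) (at x within D)"
    by (rule has_derivative_transform[OF x, rotated]) (simp add: matrix_inv_cramer[OF det])
  then show ?thesis
    by (rule differentiableI)
qed

context
  fixes D :: "R4 set" and x :: R4 and M :: "R4 \<Rightarrow> real^'n^'n"
  assumes uniq: "unique_derivs D x" and x: "x \<in> D"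
    and M: "\<And>i j. (\<lambda>z. M z $ i $ j) differentiable (at x within D)"
    and det: "\<And>z. z \<in> D \<Longrightarrow> det (M z) \<noteq> 0"
begin

text \<open>
  Differentiate \<open>matrix_inv M ** M = mat 1\<close> and multiply by the inverse from the right.
\<close>

lemma pd_matrix_inv:
  defines "dM \<equiv> \<lambda>K. \<chi> i j. pd D K (\<lambda>z. M z $ i $ j) x"
  shows "pd D K (\<lambda>z. matrix_inv (M z) $ k $ m) x = - (matrix_inv (M x) ** dM K ** matrix_inv (M x)) $ k $ m"
proof -
  note A = differentiable_matrix_inv[OF x M det]
  have inv: "invertible (M z)" if "z \<in> D" for z
    using det[OF that] by (simp add: invertible_det_nz)
  define dA where "dA = (\<chi> i j. pd D K (\<lambda>z. matrix_inv (M z) $ i $ j) x)"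
  have "(dA ** M x + matrix_inv (M x) ** dM K) $ i $ l = 0" for i l
  proof -
    have "(dA ** M x + matrix_inv (M x) ** dM K) $ i $ l
        = (\<Sum>k\<in>UNIV. pd D K (\<lambda>z. matrix_inv (M z) $ i $ k * M z $ k $ l) x)"
      using pd_mult[OF uniq A M]
      by (simp add: dA_def dM_def matrix_matrix_mult_def sum.distrib)
    also have "\<dots> = pd D K (\<lambda>z. \<Sum>k\<in>UNIV. matrix_inv (M z) $ i $ k * M z $ k $ l) x"
      by (rule pd_sum[OF uniq, symmetric]) (intro differentiable_mult A M)
    also have "\<dots> = pd D K (\<lambda>z. mat 1 $ i $ l) x"
    proof (rule pd_cong[OF x])
      fix z assume "z \<in> D"
      then have "(matrix_inv (M z) ** M z) $ i $ l = mat 1 $ i $ l"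
        using inv by (simp add: matrix_inv_left)
      then show "(\<Sum>k\<in>UNIV. matrix_inv (M z) $ i $ k * M z $ k $ l) = mat 1 $ i $ l"
        by (simp add: matrix_matrix_mult_def)
    qed
    also have "\<dots> = 0"
      by (rule pd_const[OF uniq])
    finally show ?thesis .
  qed
  then have "dA ** M x = - (matrix_inv (M x) ** dM K)"
    by (simp add: vec_eq_iff eq_neg_iff_add_eq_0)
  then have "dA ** M x ** matrix_inv (M x) = - (matrix_inv (M x) ** dM K) ** matrix_inv (M x)"
    by simp
  then have "dA = - (matrix_inv (M x) ** dM K) ** matrix_inv (M x)"
    using inv[OF x] by (simp add: matrix_inv_right flip: matrix_mul_assoc)
  also have "\<dots> = - (matrix_inv (M x) ** dM K ** matrix_inv (M x))"
    by (simp add: vec_eq_iff matrix_matrix_mult_def sum_negf)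
  finally show ?thesis
    by (simp add: dA_def vec_eq_iff)
qed

end

text \<open>
  The rows of the cofactor matrix are divergence free when \<open>M\<close> is a Jacobian matrix, which enters only
  through the symmetry \<open>curl\<close>. With \<open>A\<close> the inverse and \<open>dM K\<close> the derivative of \<open>M\<close> in direction \<open>K\<close>,
  Jacobi's formula contributes \<open>trace (dM K ** A) * A $ K $ m\<close> and the derivative of the inverse
  contributes \<open>- (A ** dM K ** A) $ K $ m\<close>; summed over \<open>K\<close> these cancel after exchanging the names of the
  two summed material indices.
\<close>

lemma piola_identity:
  fixes M :: "R4 \<Rightarrow> real^4^4"
  assumes uniq: "unique_derivs D x" and x: "x \<in> D"
    and M: "\<And>i j. (\<lambda>z. M z $ i $ j) differentiable (at x within D)"
    and det: "\<And>z. z \<in> D \<Longrightarrow> det (M z) \<noteq> 0"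
    and curl: "\<And>i K L. pd D K (\<lambda>z. M z $ i $ L) x = pd D L (\<lambda>z. M z $ i $ K) x"
  shows "(\<Sum>K\<in>UNIV. pd D K (\<lambda>z. det (M z) * matrix_inv (M z) $ K $ m) x) = 0"
proof -
  define A where "A = matrix_inv (M x)"
  define dM where "dM = (\<lambda>K. \<chi> i j. pd D K (\<lambda>z. M z $ i $ j) x)"
  have inv: "invertible (M x)"
    using det[OF x] by (simp add: invertible_det_nz)
  have J: "pd D K (\<lambda>z. det (M z)) x = trace (dM K ** A) * det (M x)" for K
  proof (rule pd_det[OF uniq M])
    have "dM K ** A ** M x = dM K"
      using inv by (simp add: A_def matrix_inv_left flip: matrix_mul_assoc)
    then show "pd D K (\<lambda>z. M z $ i $ j) x = (dM K ** A ** M x) $ i $ j" for i j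
      by (simp add: dM_def)
  qed
  have "pd D K (\<lambda>z. det (M z) * matrix_inv (M z) $ K $ m) x
      = det (M x) * (trace (dM K ** A) * A $ K $ m - (A ** dM K ** A) $ K $ m)" for K
    using pd_mult[OF uniq differentiable_det[OF M] differentiable_matrix_inv[OF x M det]]
      pd_matrix_inv[OF uniq x M det] J
    by (simp add: A_def dM_def algebra_simps)
  moreover have "(\<Sum>K\<in>UNIV. trace (dM K ** A) * A $ K $ m) = (\<Sum>K\<in>UNIV. (A ** dM K ** A) $ K $ m)"
  proof -
    have "(\<Sum>K\<in>UNIV. (A ** dM K ** A) $ K $ m)
        = (\<Sum>K\<in>UNIV. \<Sum>L\<in>UNIV. \<Sum>i\<in>UNIV. A $ K $ i * dM K $ i $ L * A $ L $ m)"
      by (simp add: matrix_matrix_mult_def sum_distrib_right)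
    also have "\<dots> = (\<Sum>L\<in>UNIV. \<Sum>K\<in>UNIV. \<Sum>i\<in>UNIV. A $ K $ i * dM K $ i $ L * A $ L $ m)"
      by (rule sum.swap)
    also have "\<dots> = (\<Sum>L\<in>UNIV. \<Sum>K\<in>UNIV. \<Sum>i\<in>UNIV. dM L $ i $ K * A $ K $ i * A $ L $ m)"
      using curl by (simp add: dM_def mult.commute)
    also have "\<dots> = (\<Sum>L\<in>UNIV. \<Sum>i\<in>UNIV. \<Sum>K\<in>UNIV. dM L $ i $ K * A $ K $ i * A $ L $ m)"
      by (intro sum.cong refl sum.swap)
    also have "\<dots> = (\<Sum>L\<in>UNIV. trace (dM L ** A) * A $ L $ m)"
      by (simp add: trace_def matrix_matrix_mult_def sum_distrib_right)
    finally show ?thesis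
      by simp
  qed
  ultimately show ?thesis
    by (simp add: sum_subtractf flip: sum_distrib_left)
qed

section \<open>The equation of state and index contractions\<close>

lemma enthalpy_derivative:
  assumes "r < 1"
  shows "(enthalpy has_real_derivative 2 / (1 - r) ^ 3) (at r)"
proof -
  have "((\<lambda>r. inverse ((1 - r)\<^sup>2)) has_real_derivative 2 / (1 - r) ^ 3) (at r)"
    using assms by (auto intro!: derivative_eq_intros simp: power2_eq_square power3_eq_cube divide_simps)
  then show ?thesis
    by (simp add: enthalpy_def[abs_def] power_int_minus)
qed

text \<open>
  Together with \<open>enthalpy_derivative\<close> this is \<open>dp = n ds\<close>.
\<close>

lemma pressure_derivative:
  assumes "r < 1"
  shows "((\<lambda>r. pressure (energy r)) has_real_derivative 2 * r / (1 - r) ^ 3) (at r)"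
proof -
  have "((\<lambda>r. (r / (1 - r))\<^sup>2) has_real_derivative 2 * r / (1 - r) ^ 3) (at r)"
    using assms by (auto intro!: derivative_eq_intros simp: power2_eq_square power3_eq_cube divide_simps)
      (simp add: algebra_simps)
  then show ?thesis
    by (simp add: pressure_def energy_def)
qed

text \<open>
  The type \<open>4\<close> is arithmetic modulo 4, so its customary enumeration by 1, 2, 3, 4 ends in the time index.
\<close>

lemma UNIV_4_zero_based: "(UNIV :: 4 set) = {0, 1, 2, 3}"
proof -
  have "(4::4) = 0"
    by simp
  then show ?thesis
    unfolding UNIV_4 \<open>4 = 0\<close> by auto
qed

lemma lower_eq: "lower w \<mu> = mink $ \<mu> $ \<mu> * w $ \<mu>"
proof -
  have "lower w \<mu> = (\<Sum>\<nu>\<in>UNIV. if \<nu> = \<mu> then mink $ \<mu> $ \<mu> * w $ \<mu> else 0)"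
    unfolding lower_def by (intro sum.cong) (auto simp: mink_def)
  then show ?thesis
    by simp
qed

lemma mink_contract: "(\<Sum>\<nu>\<in>UNIV. mink $ \<mu> $ \<nu> * w \<nu>) = mink $ \<mu> $ \<mu> * w \<mu>"
  using lower_eq[of "\<chi> \<nu>. w \<nu>" \<mu>] by (simp add: lower_def)

lemma mink_diag_square: "mink $ \<mu> $ \<mu> * mink $ \<mu> $ \<mu> = 1"
  by (simp add: mink_def)

lemma eq_iff_of_difference_eq:
  fixes a b c d :: real
  assumes "a - b = c * d" "c \<noteq> 0"
  shows "a = b \<longleftrightarrow> d = 0"
  using assms by auto

section \<open>The flow map and its Jacobian\<close>

lemma bounded_linear_init_pt: "bounded_linear init_pt"
  unfolding linear_conv_bounded_linear[symmetric]
  by (rule linearI) (simp_all add: init_pt_def vec_eq_iff)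

text \<open>
  The setting in which the two formulations are compared: a flow of a smooth future-directed field,
  with a smooth subluminal density. None of the equations of motion is part of it.
\<close>

locale fluid_motion =
  fixes I :: "real set" and n :: "R4 \<Rightarrow> real" and u \<eta> :: "R4 \<Rightarrow> R4"
  assumes interval: "is_interval I" "interior I \<noteq> {}" "0 \<in> I"
    and flow: "flow_map I u \<eta>"
    and smooth: "smooth_upto (lagr_domain I) \<eta>" "smooth_upto (fluid_region I \<eta>) n"
      "smooth_upto (fluid_region I \<eta>) u"
    and n_range: "\<And>x. x \<in> fluid_region I \<eta> \<Longrightarrow> 0 \<le> n x \<and> n x < 1/3"
    and future_directed: "\<And>x. x \<in> fluid_region I \<eta> \<Longrightarrow> u x $ 0 > 0"
    and material_manifold: "closure {x \<in> fluid_region I \<eta>. x $ 0 = 0 \<and> n x > 0} = material"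
begin

abbreviation \<Omega> where "\<Omega> \<equiv> lagr_domain I"
abbreviation D where "D \<equiv> fluid_region I \<eta>"
abbreviation M where "M \<equiv> Mmat \<Omega> \<eta>"
abbreviation A where "A \<equiv> Amat \<Omega> \<eta>"
abbreviation J where "J \<equiv> Jdet \<Omega> \<eta>"

lemma unique_derivs_Omega:
  assumes "y \<in> \<Omega>"
  shows "unique_derivs \<Omega> y"
proof (rule unique_derivs_convex[OF _ assms])
  have "convex I"
    using interval by (simp add: is_interval_convex)
  then show "convex \<Omega>"
    by (auto simp: lagr_domain_def convex_def convex_bound_le intro!: add_nonneg_nonneg)
next
  fix K :: 4
  consider "K = 0" | "K = 1 \<or> K = 2" | "K = 3"
    using UNIV_4_zero_based by blast
  then show "\<exists>q. q \<noteq> 0 \<and> y + q *\<^sub>R axis K 1 \<in> \<Omega>"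
  proof cases
    case 1
    obtain t where "t \<in> I" "t \<noteq> y $ 0"
      using interval(2) by (metis empty_interior_finite finite.emptyI finite_insert insertI1 subsetI finite_subset)
    then show ?thesis
      using assms 1 by (intro exI[of _ "t - y $ 0"]) (auto simp: lagr_domain_def axis_def)
  next
    case 2
    then show ?thesis
      using assms by (intro exI[of _ 1]) (auto simp: lagr_domain_def axis_def)
  next
    case 3
    then show ?thesis
      using assms by (intro exI[of _ "if y $ 3 \<le> 1/2 then 1/2 else - 1/2"]) (auto simp: lagr_domain_def axis_def)
  qed
qed

lemma image_in_D: "y \<in> \<Omega> \<Longrightarrow> \<eta> y \<in> D"
  by (simp add: fluid_region_def)

lemma eta_has_derivative:
  assumes "y \<in> \<Omega>"
  shows "(\<eta> has_derivative (*v) (M y)) (at y within \<Omega>)"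
proof -
  obtain E where E: "(\<eta> has_derivative E) (at y within \<Omega>)"
    using smooth_upto_C1[OF smooth(1)] assms by metis
  have "M y $ i $ K = E (axis K 1) $ i" for i K
    using pd_eq[OF unique_derivs_Omega[OF assms] bounded_linear.has_derivative[OF bounded_linear_vec_nth E]]
    by (simp add: Mmat_def)
  then have "M y = matrix E"
    by (simp add: matrix_def vec_eq_iff)
  then have "(*v) (M y) = E"
    using matrix_vector_mul(2)[OF has_derivative_linear[OF E]] by simp
  then show ?thesis
    using E by simp
qed

text \<open>
  For a smooth extension of \<open>\<eta>\<close> the columns of \<open>M\<close> are its directional derivatives, and
  the second claim is the symmetry of its second derivative.
\<close>

lemma M_second_order:
  assumes "y \<in> \<Omega>"
  shows M_differentiable: "(\<lambda>z. M z $ i $ K) differentiable (at y within \<Omega>)"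
    and M_curl_free: "pd \<Omega> L (\<lambda>z. M z $ i $ K) y = pd \<Omega> K (\<lambda>z. M z $ i $ L) y"
proof -
  obtain \<eta>' \<eta>'' where \<eta>': "\<And>x. x \<in> \<Omega> \<Longrightarrow> (\<eta> has_derivative \<eta>' x) (at x within \<Omega>)"
    and \<eta>'': "\<And>x w. x \<in> \<Omega> \<Longrightarrow> ((\<lambda>x. \<eta>' x w) has_derivative \<eta>'' w x) (at x within \<Omega>)"
    and sym: "\<And>x w w'. x \<in> \<Omega> \<Longrightarrow> \<eta>'' w x w' = \<eta>'' w' x w"
    using smooth_upto_C2[OF smooth(1)] by metis
  have M: "M z $ i $ K = \<eta>' z (axis K 1) $ i" if "z \<in> \<Omega>" for i K z
    using pd_eq[OF unique_derivs_Omega[OF that] bounded_linear.has_derivative[OF bounded_linear_vec_nth \<eta>'[OF that]]]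
    by (simp add: Mmat_def)
  have dM: "((\<lambda>z. M z $ i $ K) has_derivative (\<lambda>h. \<eta>'' (axis K 1) y h $ i)) (at y within \<Omega>)" for i K
    by (rule has_derivative_transform[OF assms M
          bounded_linear.has_derivative[OF bounded_linear_vec_nth \<eta>''[OF assms]]])
  then show "(\<lambda>z. M z $ i $ K) differentiable (at y within \<Omega>)"
    by (rule differentiableI)
  show "pd \<Omega> L (\<lambda>z. M z $ i $ K) y = pd \<Omega> K (\<lambda>z. M z $ i $ L) y"
    using pd_eq[OF unique_derivs_Omega[OF assms] dM] sym[OF assms] by simp
qed

lemma has_derivative_compose_flow:
  assumes "y \<in> \<Omega>" "(h has_derivative L) (at (\<eta> y) within D)"
  shows "((\<lambda>z. h (\<eta> z)) has_derivative (\<lambda>w. L (M y *v w))) (at y within \<Omega>)"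
  using has_derivative_in_compose[OF eta_has_derivative] assms
  by (simp add: fluid_region_def)

lemma pd_compose_flow:
  assumes y: "y \<in> \<Omega>" and L: "(h has_derivative L) (at (\<eta> y) within D)"
  shows "pd \<Omega> K (\<lambda>z. h (\<eta> z)) y = (\<Sum>\<alpha>\<in>UNIV. L (axis \<alpha> 1) * M y $ \<alpha> $ K)"
proof -
  interpret L: bounded_linear L
    using L by (rule has_derivative_bounded_linear)
  have "M y *v axis K 1 = (\<Sum>\<alpha>\<in>UNIV. M y $ \<alpha> $ K *\<^sub>R axis \<alpha> 1)"
    by (simp add: vec_eq_iff matrix_vector_mult_basis column_def) (simp add: axis_def if_distrib cong: if_cong)
  then have "L (M y *v axis K 1) = (\<Sum>\<alpha>\<in>UNIV. L (axis \<alpha> 1) * M y $ \<alpha> $ K)"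
    by (simp add: L.sum L.scaleR mult.commute)
  then show ?thesis
    using pd_eq[OF unique_derivs_Omega[OF y] has_derivative_compose_flow[OF y L]] by simp
qed

lemma M_time_column: "y \<in> \<Omega> \<Longrightarrow> M y $ i $ 0 = u (\<eta> y) $ i"
  using flow by (simp add: Mmat_def flow_map_def)

lemma u_component_has_derivative:
  "(u has_derivative u') F \<Longrightarrow> ((\<lambda>x. u x $ i) has_derivative (\<lambda>h. u' h $ i)) F"
  by (rule bounded_linear.has_derivative[OF bounded_linear_vec_nth])

lemma J_differentiable: "y \<in> \<Omega> \<Longrightarrow> J differentiable (at y within \<Omega>)"
  unfolding Jdet_def by (rule differentiable_det[OF M_differentiable])

text \<open>
  The velocity is the time column of \<open>M\<close>, so commuting derivatives gives \<open>\<partial>\<^sub>\<tau> M = B ** M\<close> with \<open>B\<close> the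
  derivative of \<open>u\<close>, and Jacobi's formula applies.
\<close>

lemma pd_J_time:
  assumes y: "y \<in> \<Omega>" and u': "(u has_derivative u') (at (\<eta> y) within D)"
  shows "pd \<Omega> 0 J y = (\<Sum>\<alpha>\<in>UNIV. u' (axis \<alpha> 1) $ \<alpha>) * J y"
proof -
  define B where "B = (\<chi> i \<alpha>. u' (axis \<alpha> 1) $ i)"
  have "pd \<Omega> 0 (\<lambda>z. M z $ i $ K) y = (B ** M y) $ i $ K" for i K
  proof -
    have "pd \<Omega> 0 (\<lambda>z. M z $ i $ K) y = pd \<Omega> K (\<lambda>z. M z $ i $ 0) y"
      by (rule M_curl_free[OF y])
    also have "\<dots> = pd \<Omega> K (\<lambda>z. u (\<eta> z) $ i) y"
      using M_time_column by (intro pd_cong[OF y])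
    also have "\<dots> = (B ** M y) $ i $ K"
      using pd_compose_flow[OF y u_component_has_derivative[OF u']]
      by (simp add: B_def matrix_matrix_mult_def)
    finally show ?thesis .
  qed
  from pd_det[OF unique_derivs_Omega[OF y] M_differentiable[OF y] this]
  show ?thesis
    by (simp add: Jdet_def[abs_def] B_def trace_def)
qed

lemma init_pt_in_material: "y \<in> \<Omega> \<Longrightarrow> init_pt y \<in> material"
  by (simp add: lagr_domain_def material_def init_pt_def)

lemma material_subset: "material \<subseteq> \<Omega>"
  using interval(3) by (auto simp: lagr_domain_def material_def)

lemma init_pt_in_Omega: "y \<in> \<Omega> \<Longrightarrow> init_pt y \<in> \<Omega>"
  using init_pt_in_material material_subset by blast

lemma eta_material: "y \<in> material \<Longrightarrow> \<eta> y = y"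
  using flow by (simp add: flow_map_def)

lemma has_derivative_compose_init_pt:
  assumes "y \<in> \<Omega>" "(g has_derivative L) (at (init_pt y) within \<Omega>)"
  shows "((\<lambda>z. g (init_pt z)) has_derivative (\<lambda>h. L (init_pt h))) (at y within \<Omega>)"
proof (rule has_derivative_in_compose[OF bounded_linear_imp_has_derivative[OF bounded_linear_init_pt]])
  show "(g has_derivative L) (at (init_pt y) within init_pt ` \<Omega>)"
    using init_pt_in_Omega by (intro has_derivative_subset[OF assms(2)]) auto
qed

text \<open>
  Initially \<open>M\<close> is the identity matrix with its time column replaced by \<open>u\<close>.
\<close>

lemma J_material:
  assumes "y \<in> material"
  shows "J y = u y $ 0"
proof -
  have y: "y \<in> \<Omega>"
    using assms material_subset by blast
  have init: "init_pt y = y"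
    using assms by (auto simp: material_def init_pt_def vec_eq_iff)
  \<comment> \<open>composing with the linear projection \<open>init_pt\<close> compares the spatial derivatives of \<open>\<eta>\<close> with those of the identity, without leaving derivatives within \<open>\<Omega>\<close>\<close>
  have "((\<lambda>z. \<eta> (init_pt z)) has_derivative (\<lambda>h. M y *v init_pt h)) (at y within \<Omega>)"
    using has_derivative_compose_init_pt[OF y] eta_has_derivative[OF y] by (simp add: init)
  then have "((\<lambda>z. \<eta> (init_pt z) $ i) has_derivative (\<lambda>h. (M y *v init_pt h) $ i)) (at y within \<Omega>)" for i
    by (rule bounded_linear.has_derivative[OF bounded_linear_vec_nth])
  moreover have "((\<lambda>z. \<eta> (init_pt z) $ i) has_derivative (\<lambda>h. init_pt h $ i)) (at y within \<Omega>)" for i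
  proof (rule has_derivative_transform[OF y])
    show "((\<lambda>z. init_pt z $ i) has_derivative (\<lambda>h. init_pt h $ i)) (at y within \<Omega>)"
      by (intro bounded_linear.has_derivative[OF bounded_linear_vec_nth]
          bounded_linear_imp_has_derivative[OF bounded_linear_init_pt])
  qed (simp add: eta_material init_pt_in_material)
  ultimately have eq: "(M y *v init_pt w) $ i = init_pt w $ i" for i w
    using unique_derivs_Omega[OF y] unfolding unique_derivs_def by metis
  have "M y $ i $ K = (if K = 0 then (mat 1 *v u y) $ i else mat 1 $ i $ K)" for i K
  proof (cases "K = 0")
    case True
    then show ?thesis
      using M_time_column[OF y] eta_material[OF assms] by simp
  next
    case False
    then have "init_pt (axis K 1) = axis K 1"
      by (simp add: init_pt_def axis_def vec_eq_iff)
    then show ?thesis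
      using False eq[of "axis K 1" i]
      by (simp add: matrix_vector_mult_basis column_def) (simp add: axis_def mat_def)
  qed
  \<comment> \<open>in this form the determinant is an instance of Cramer's rule\<close>
  then have "M y = (\<chi> i K. if K = 0 then (mat 1 *v u y) $ i else mat 1 $ i $ K)"
    by (simp add: vec_eq_iff)
  then show ?thesis
    using cramer_lemma[of 0 "mat 1" "u y"] by (simp add: Jdet_def)
qed

definition time_line :: "R4 \<Rightarrow> real \<Rightarrow> R4" where
  "time_line y s = init_pt y + s *\<^sub>R axis 0 1"

lemma time_line_in_Omega: "y \<in> \<Omega> \<Longrightarrow> s \<in> I \<Longrightarrow> time_line y s \<in> \<Omega>"
  by (simp add: time_line_def lagr_domain_def init_pt_def axis_def)

lemma time_line_0: "time_line y 0 = init_pt y"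
  by (simp add: time_line_def)

lemma time_line_self: "time_line y (y $ 0) = y"
  by (simp add: time_line_def init_pt_def axis_def vec_eq_iff)

lemma time_line_derivative:
  assumes y: "y \<in> \<Omega>" "s \<in> I" and g: "g differentiable (at (time_line y s) within \<Omega>)"
  shows "((\<lambda>s. g (time_line y s)) has_real_derivative pd \<Omega> 0 g (time_line y s)) (at s within I)"
proof -
  note mem = time_line_in_Omega[OF y(1)]
  obtain L where L: "(g has_derivative L) (at (time_line y s) within \<Omega>)"
    using g unfolding differentiable_def by blast
  interpret L: bounded_linear L
    using L by (rule has_derivative_bounded_linear)
  have "(time_line y has_derivative (\<lambda>r. r *\<^sub>R axis 0 1)) (at s within I)"
    unfolding time_line_def by (auto intro!: derivative_eq_intros)
  moreover have "(g has_derivative L) (at (time_line y s) within time_line y ` I)"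
    using mem by (intro has_derivative_subset[OF L]) auto
  ultimately have "((\<lambda>s. g (time_line y s)) has_derivative (\<lambda>r. L (r *\<^sub>R axis 0 1))) (at s within I)"
    by (rule has_derivative_in_compose)
  then show ?thesis
    using pd_eq[OF unique_derivs_Omega[OF mem[OF y(2)]] L]
    by (simp add: has_field_derivative_def L.scaleR mult_commute_abs)
qed

lemma continuous_on_eta: "continuous_on \<Omega> \<eta>"
  by (rule has_derivative_continuous_on[OF eta_has_derivative])

lemma J_pos:
  assumes y: "y \<in> \<Omega>"
  shows "J y > 0"
proof -
  obtain u' where u': "\<And>x. x \<in> D \<Longrightarrow> (u has_derivative u' x) (at x within D)"
    and u'_cont: "\<And>w. continuous_on D (\<lambda>x. u' x w)"
    using smooth_upto_C1[OF smooth(3)] by metis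
  note mem = time_line_in_Omega[OF y]
  define c where "c = (\<lambda>s. \<Sum>\<alpha>\<in>UNIV. u' (\<eta> (time_line y s)) (axis \<alpha> 1) $ \<alpha>)"
  have "J (time_line y (y $ 0)) > 0"
  proof (rule linear_ode_pos[where j = "\<lambda>s. J (time_line y s)" and c = c, OF interval(1,3)])
    show "y $ 0 \<in> I"
      using y by (simp add: lagr_domain_def)
    show "((\<lambda>s. J (time_line y s)) has_real_derivative c s * J (time_line y s)) (at s within I)"
      if s: "s \<in> I" for s
      using time_line_derivative[OF y s J_differentiable[OF mem[OF s]]]
        pd_J_time[OF mem[OF s] u'[OF image_in_D[OF mem[OF s]]]] by (simp add: c_def)
    have "continuous_on I (time_line y)"
      unfolding time_line_def by (intro continuous_intros)
    then have "continuous_on I (\<lambda>s. \<eta> (time_line y s))"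
      by (rule continuous_on_compose2[OF continuous_on_eta]) (use mem in auto)
    then show "continuous_on I c"
      unfolding c_def
      by (intro continuous_on_sum continuous_on_component continuous_on_compose2[OF u'_cont])
        (use mem image_in_D in auto)
    show "J (time_line y 0) > 0"
      using J_material[OF init_pt_in_material[OF y]] future_directed
        eta_material[OF init_pt_in_material[OF y]] image_in_D[OF init_pt_in_Omega[OF y]]
      by (simp add: time_line_0)
  qed
  then show ?thesis
    by (simp add: time_line_self)
qed

lemma M_invertible: "y \<in> \<Omega> \<Longrightarrow> invertible (M y)"
  using J_pos[of y] by (simp add: invertible_det_nz Jdet_def)

lemma unique_derivs_D:
  assumes "y \<in> \<Omega>"
  shows "unique_derivs D (\<eta> y)"
  unfolding fluid_region_def
proof (rule unique_derivs_image[OF unique_derivs_Omega eta_has_derivative])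
  have "M y *v (A y *v w) = w" for w
    using matrix_inv_right[OF M_invertible[OF assms]]
    by (simp add: Amat_def matrix_vector_mul_assoc)
  then show "surj ((*v) (M y))"
    by (rule surjI)
qed (fact assms)+

lemma differentiable_compose_flow:
  "y \<in> \<Omega> \<Longrightarrow> h differentiable (at (\<eta> y) within D) \<Longrightarrow> (\<lambda>z. h (\<eta> z)) differentiable (at y within \<Omega>)"
  using has_derivative_compose_flow unfolding differentiable_def by blast

lemma pd_flow:
  assumes y: "y \<in> \<Omega>" and h: "h differentiable (at (\<eta> y) within D)"
  shows "pd \<Omega> K (\<lambda>z. h (\<eta> z)) y = (\<Sum>\<alpha>\<in>UNIV. pd D \<alpha> h (\<eta> y) * M y $ \<alpha> $ K)"
  using pd_compose_flow[OF y] h by (simp add: frechet_derivative_works pd_def)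

text \<open>
  The chain rule says that the Lagrangian gradient is the spacetime gradient times \<open>M\<close>; invert \<open>M\<close>.
\<close>

lemma pd_flow_inverse:
  assumes y: "y \<in> \<Omega>" and h: "h differentiable (at (\<eta> y) within D)"
  shows "pd D \<alpha> h (\<eta> y) = (\<Sum>K\<in>UNIV. A y $ K $ \<alpha> * pd \<Omega> K (\<lambda>z. h (\<eta> z)) y)"
proof -
  define g where "g = (\<chi> \<alpha>. pd D \<alpha> h (\<eta> y))"
  have "(\<chi> K. pd \<Omega> K (\<lambda>z. h (\<eta> z)) y) = g v* M y"
    using pd_flow[OF assms] by (simp add: g_def vector_matrix_mult_def mult.commute)
  then have "(\<chi> K. pd \<Omega> K (\<lambda>z. h (\<eta> z)) y) v* A y = g"
    using matrix_inv_right[OF M_invertible[OF y]]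
    by (simp add: Amat_def vector_matrix_mul_assoc)
  then have "((\<chi> K. pd \<Omega> K (\<lambda>z. h (\<eta> z)) y) v* A y) $ \<alpha> = g $ \<alpha>"
    by simp
  then show ?thesis
    by (simp add: g_def vector_matrix_mult_def mult.commute)
qed

lemma pd_flow_time:
  assumes "y \<in> \<Omega>" "h differentiable (at (\<eta> y) within D)"
  shows "(\<Sum>\<alpha>\<in>UNIV. u (\<eta> y) $ \<alpha> * pd D \<alpha> h (\<eta> y)) = pd \<Omega> 0 (\<lambda>z. h (\<eta> z)) y"
  using pd_flow[OF assms] M_time_column[OF assms(1)] by (simp add: mult.commute)

section \<open>The Lagrangian unknowns\<close>

abbreviation f where "f \<equiv> (\<lambda>y. n (\<eta> y))"
abbreviation v where "v \<equiv> (\<lambda>y. u (\<eta> y))"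
abbreviation S where "S \<equiv> (\<lambda>y. enthalpy (f y))"
abbreviation F where "F \<equiv> (\<lambda>y. n (init_pt y) * u (init_pt y) $ 0)"

lemma f_range: "y \<in> \<Omega> \<Longrightarrow> 0 \<le> f y \<and> f y < 1/3"
  using n_range image_in_D by blast

lemma n_differentiable: "x \<in> D \<Longrightarrow> n differentiable (at x within D)"
  using smooth_upto_C1[OF smooth(2)] differentiableI by metis

lemma u_differentiable: "x \<in> D \<Longrightarrow> (\<lambda>x. u x $ i) differentiable (at x within D)"
  using smooth_upto_C1[OF smooth(3)] u_component_has_derivative differentiableI by metis

lemma f_differentiable: "y \<in> \<Omega> \<Longrightarrow> f differentiable (at y within \<Omega>)"
  by (intro differentiable_compose_flow n_differentiable image_in_D)

lemma v_differentiable: "y \<in> \<Omega> \<Longrightarrow> (\<lambda>z. v z $ i) differentiable (at y within \<Omega>)"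
  by (intro differentiable_compose_flow[where h = "\<lambda>x. u x $ i"] u_differentiable image_in_D)

lemma A_differentiable: "y \<in> \<Omega> \<Longrightarrow> (\<lambda>z. A z $ K $ \<mu>) differentiable (at y within \<Omega>)"
  unfolding Amat_def
proof (rule differentiable_matrix_inv[OF _ M_differentiable])
  show "det (M z) \<noteq> 0" if "z \<in> \<Omega>" for z
    using J_pos[OF that] by (simp add: Jdet_def)
qed

lemma piola:
  assumes y: "y \<in> \<Omega>"
  shows "(\<Sum>K\<in>UNIV. pd \<Omega> K (\<lambda>z. J z * A z $ K $ \<mu>) y) = 0"
  unfolding Jdet_def Amat_def
proof (rule piola_identity[OF unique_derivs_Omega[OF y] y M_differentiable[OF y] _ M_curl_free[OF y]])
  show "det (M z) \<noteq> 0" if "z \<in> \<Omega>" for z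
    using J_pos[OF that] by (simp add: Jdet_def)
qed

lemma pd_compose_f:
  assumes "y \<in> \<Omega>" "(\<phi> has_real_derivative d) (at (f y))"
  shows "pd \<Omega> K (\<lambda>z. \<phi> (f z)) y = d * pd \<Omega> K f y"
  by (rule pd_compose_real[OF unique_derivs_Omega[OF assms(1)] f_differentiable[OF assms(1)] assms(2)])

lemma pd_S: "y \<in> \<Omega> \<Longrightarrow> pd \<Omega> K S y = 2 / (1 - f y) ^ 3 * pd \<Omega> K f y"
  using f_range[of y] by (intro pd_compose_f enthalpy_derivative) auto

lemma pd_pressure: "y \<in> \<Omega> \<Longrightarrow> pd \<Omega> K (\<lambda>z. pressure (energy (f z))) y = f y * pd \<Omega> K S y"
  using f_range[of y] pd_compose_f[OF _ pressure_derivative, of y K] pd_S[of y K] by auto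

lemma S_differentiable: "y \<in> \<Omega> \<Longrightarrow> S differentiable (at y within \<Omega>)"
  using f_range[of y]
  by (intro differentiable_compose_real[OF f_differentiable enthalpy_derivative]) auto

lemma pressure_differentiable:
  "x \<in> D \<Longrightarrow> (\<lambda>x. pressure (energy (n x))) differentiable (at x within D)"
  using n_range[of x]
  by (intro differentiable_compose_real[OF n_differentiable pressure_derivative]) auto

text \<open>
  The fractional powers of \<open>S\<close> in the equations are integer powers of \<open>1 - f\<close>, which turns all later
  comparisons into rational identities.
\<close>

lemma S_powers:
  assumes "y \<in> \<Omega>"
  shows "S y = 1 / (1 - f y)\<^sup>2" "S y powr (3/2) = 1 / (1 - f y) ^ 3" "S y powr (-1/2) = 1 - f y"
proof -
  have r: "1 - f y > 0"
    using f_range[OF assms] by simp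
  show S: "S y = 1 / (1 - f y)\<^sup>2"
    by (simp add: enthalpy_def power_int_minus divide_inverse)
  have S': "S y = (1 - f y) powr (-2)"
    using r S by (simp add: powr_minus powr_numeral divide_inverse)
  have "S y powr (3/2) = (1 - f y) powr (- 3)"
    unfolding S' powr_powr by simp
  also have "\<dots> = 1 / (1 - f y) ^ 3"
    using powr_numeral[of "1 - f y" "num.Bit1 num.One"] r by (simp only: powr_minus_divide less_imp_le)
  finally show "S y powr (3/2) = 1 / (1 - f y) ^ 3" .
  have "S y powr (-1/2) = (1 - f y) powr 1"
    unfolding S' powr_powr by simp
  then show "S y powr (-1/2) = 1 - f y"
    using r by (simp only: powr_one less_imp_le)
qed

lemma pd_lower:
  assumes "y \<in> \<Omega>" "(\<lambda>z. w z $ \<mu>) differentiable (at y within \<Omega>)"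
  shows "pd \<Omega> K (\<lambda>z. lower (w z) \<mu>) y = mink $ \<mu> $ \<mu> * pd \<Omega> K (\<lambda>z. w z $ \<mu>) y"
  unfolding lower_eq using assms
  by (simp add: pd_mult[OF unique_derivs_Omega] pd_const[OF unique_derivs_Omega])

section \<open>Conservation of mass\<close>

text \<open>
  The initial data enter through \<^const>\<open>init_pt\<close>, which is why \<open>F\<close> has a derivative that factors
  through it and therefore vanishes in the time direction.
\<close>

lemma F_has_derivative:
  assumes y: "y \<in> \<Omega>"
  obtains L where "(F has_derivative (\<lambda>h. L (init_pt h))) (at y within \<Omega>)" "linear L"
proof -
  have "(\<lambda>z. f z * v z $ 0) differentiable (at (init_pt y) within \<Omega>)"
    by (intro differentiable_mult f_differentiable v_differentiable init_pt_in_Omega y)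
  then obtain L where L: "((\<lambda>z. f z * v z $ 0) has_derivative L) (at (init_pt y) within \<Omega>)"
    unfolding differentiable_def by blast
  have "(F has_derivative (\<lambda>h. L (init_pt h))) (at y within \<Omega>)"
    by (rule has_derivative_transform[OF y _ has_derivative_compose_init_pt[OF y L]])
      (simp add: eta_material init_pt_in_material)
  then show thesis
    using that has_derivative_linear[OF L] by blast
qed

lemma pd_F_time:
  assumes y: "y \<in> \<Omega>"
  shows "pd \<Omega> 0 F y = 0"
proof -
  obtain L where L: "(F has_derivative (\<lambda>h. L (init_pt h))) (at y within \<Omega>)" "linear L"
    by (rule F_has_derivative[OF y])
  have "init_pt (axis 0 1) = 0"
    by (simp add: init_pt_def axis_def vec_eq_iff)
  then show ?thesis
    using pd_eq[OF unique_derivs_Omega[OF y] L(1), of 0] linear_0[OF L(2)] by simp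
qed

lemma pd_mass_density:
  assumes y: "y \<in> \<Omega>"
  shows "pd \<Omega> K (\<lambda>z. f z * J z) y = pd \<Omega> K f y * J y + f y * pd \<Omega> K J y"
  by (rule pd_mult[OF unique_derivs_Omega[OF y] f_differentiable[OF y] J_differentiable[OF y]])

text \<open>
  The continuity equation along the flow: \<open>\<partial>\<^sub>\<tau> f\<close> contributes \<open>u\<^sup>\<alpha> \<partial>\<^sub>\<alpha> n\<close> and \<open>\<partial>\<^sub>\<tau> J\<close> contributes \<open>n div u\<close>,
  each times \<open>J\<close>.
\<close>

lemma pd_mass_density_time:
  assumes y: "y \<in> \<Omega>"
  shows "pd \<Omega> 0 (\<lambda>z. f z * J z) y = (\<Sum>\<alpha>\<in>UNIV. pd D \<alpha> (\<lambda>x. n x * u x $ \<alpha>) (\<eta> y)) * J y"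
proof -
  note x = image_in_D[OF y]
  obtain u' where u': "(u has_derivative u') (at (\<eta> y) within D)"
    using smooth_upto_C1[OF smooth(3)] x by metis
  have "pd D \<alpha> (\<lambda>x. n x * u x $ \<alpha>) (\<eta> y)
      = v y $ \<alpha> * pd D \<alpha> n (\<eta> y) + f y * u' (axis \<alpha> 1) $ \<alpha>" for \<alpha>
    using pd_mult[OF unique_derivs_D[OF y] n_differentiable[OF x] u_differentiable[OF x]]
      pd_eq[OF unique_derivs_D[OF y] u_component_has_derivative[OF u']] by (simp add: mult.commute)
  then show ?thesis
    using pd_flow_time[OF y n_differentiable[OF x]] pd_J_time[OF y u'] pd_mass_density[OF y, of 0]
    by (simp add: sum.distrib distrib_left distrib_right flip: sum_distrib_left)
qed

text \<open>
  The divergence vanishes if and only if \<open>f J\<close> is constant along each time line, since \<open>J\<close> is nonzero;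
  its value at time zero is \<open>F\<close> because \<open>J\<close> equals the time component of \<open>u\<close> there.
\<close>

lemma mass_eq_iff:
  "mass_eq \<Omega> \<eta> F f \<longleftrightarrow> (\<forall>x\<in>D. (\<Sum>\<alpha>\<in>UNIV. pd D \<alpha> (\<lambda>x. n x * u x $ \<alpha>) x) = 0)"
proof -
  have "mass_eq \<Omega> \<eta> F f \<longleftrightarrow> (\<forall>y\<in>\<Omega>. pd \<Omega> 0 (\<lambda>z. f z * J z) y = 0)"
  proof
    assume mass: "mass_eq \<Omega> \<eta> F f"
    have "pd \<Omega> 0 (\<lambda>z. f z * J z) y = pd \<Omega> 0 F y" if "y \<in> \<Omega>" for y
      using mass by (intro pd_cong[OF that]) (simp add: mass_eq_def)
    then show "\<forall>y\<in>\<Omega>. pd \<Omega> 0 (\<lambda>z. f z * J z) y = 0"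
      using pd_F_time by simp
  next
    assume zero: "\<forall>y\<in>\<Omega>. pd \<Omega> 0 (\<lambda>z. f z * J z) y = 0"
    have "f y * J y = F y" if y: "y \<in> \<Omega>" for y
    proof -
      have "((\<lambda>s. f (time_line y s) * J (time_line y s)) has_real_derivative 0) (at s within I)"
        if s: "s \<in> I" for s
      proof -
        note z = time_line_in_Omega[OF y s]
        have "(\<lambda>z. f z * J z) differentiable (at (time_line y s) within \<Omega>)"
          by (intro differentiable_mult f_differentiable J_differentiable z)
        from time_line_derivative[OF y s this] show ?thesis
          using zero z by simp
      qed
      from has_field_derivative_zero_constant[OF is_interval_convex[OF interval(1)] this]
      obtain c where "\<And>s. s \<in> I \<Longrightarrow> f (time_line y s) * J (time_line y s) = c"
        by blast
      moreover have "y $ 0 \<in> I"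
        using y by (simp add: lagr_domain_def)
      ultimately have "f (time_line y (y $ 0)) * J (time_line y (y $ 0)) = f (time_line y 0) * J (time_line y 0)"
        using interval(3) by simp
      then show ?thesis
        using J_material[OF init_pt_in_material[OF y]] eta_material[OF init_pt_in_material[OF y]]
        by (simp add: time_line_self time_line_0)
    qed
    then show "mass_eq \<Omega> \<eta> F f"
      by (simp add: mass_eq_def)
  qed
  also have "\<dots> \<longleftrightarrow> (\<forall>y\<in>\<Omega>. (\<Sum>\<alpha>\<in>UNIV. pd D \<alpha> (\<lambda>x. n x * u x $ \<alpha>) (\<eta> y)) = 0)"
  proof (intro ball_cong refl)
    fix y assume y: "y \<in> \<Omega>"
    show "pd \<Omega> 0 (\<lambda>z. f z * J z) y = 0
        \<longleftrightarrow> (\<Sum>\<alpha>\<in>UNIV. pd D \<alpha> (\<lambda>x. n x * u x $ \<alpha>) (\<eta> y)) = 0"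
      unfolding pd_mass_density_time[OF y] using J_pos[OF y] by simp
  qed
  finally show ?thesis
    by (simp add: fluid_region_def)
qed

section \<open>Balance of momentum\<close>

text \<open>
  The product rule has been carried out in the first term so that this is visibly continuous; see
  \<open>momentum_eq_Sv_form_iff\<close> for the equation it belongs to.
\<close>

definition momentum_defect :: "4 \<Rightarrow> R4 \<Rightarrow> real" where
  "momentum_defect \<mu> y = S y * pd \<Omega> 0 (\<lambda>z. lower (v z) \<mu>) y + lower (v y) \<mu> * pd \<Omega> 0 S y
     + (\<Sum>K\<in>UNIV. A y $ K $ \<mu> * pd \<Omega> K S y)"

lemma momentum_eq_Sv_form_iff:
  "momentum_eq_Sv_form \<Omega> \<eta> S v \<mu> \<longleftrightarrow> (\<forall>y\<in>\<Omega>. momentum_defect \<mu> y = 0)"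
proof -
  have "pd \<Omega> 0 (\<lambda>z. S z * lower (v z) \<mu>) y = S y * pd \<Omega> 0 (\<lambda>z. lower (v z) \<mu>) y + lower (v y) \<mu> * pd \<Omega> 0 S y"
    if y: "y \<in> \<Omega>" for y
  proof -
    have "(\<lambda>z. lower (v z) \<mu>) differentiable (at y within \<Omega>)"
      unfolding lower_eq by (intro differentiable_mult differentiable_const v_differentiable y)
    then show ?thesis
      using pd_mult[OF unique_derivs_Omega[OF y] S_differentiable[OF y]] by simp
  qed
  then show ?thesis
    by (simp add: momentum_eq_Sv_form_def momentum_defect_def)
qed

text \<open>
  Use \<open>u\<^sup>\<alpha> \<partial>\<^sub>\<alpha> = \<partial>\<^sub>\<tau>\<close> along the flow, \<open>\<rho> + p = f S\<close> and \<open>\<partial>\<^sub>K p = f \<partial>\<^sub>K S\<close>: every term carries a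
  factor \<open>f\<close>. The sign \<open>mink $ \<mu> $ \<mu>\<close> comes from the index \<open>\<mu>\<close>, which is an upper one in the Euler
  equations and a lower one in the defect.
\<close>

lemma euler_momentum_residual:
  assumes y: "y \<in> \<Omega>"
  shows "(energy (n (\<eta> y)) + pressure (energy (n (\<eta> y)))) * (\<Sum>\<alpha>\<in>UNIV. u (\<eta> y) $ \<alpha> * pd D \<alpha> (\<lambda>x. u x $ \<mu>) (\<eta> y))
      + (\<Sum>\<alpha>\<in>UNIV. (u (\<eta> y) $ \<mu> * u (\<eta> y) $ \<alpha> + mink $ \<mu> $ \<alpha>) * pd D \<alpha> (\<lambda>x. pressure (energy (n x))) (\<eta> y))
    = mink $ \<mu> $ \<mu> * f y * momentum_defect \<mu> y" (is "?lhs = _")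
proof -
  let ?P = "\<lambda>x. pressure (energy (n x))" and ?g = "mink $ \<mu> $ \<mu>"
  note x = image_in_D[OF y]
  note P = pressure_differentiable[OF x]
  have "f y < 1"
    using f_range[OF y] by simp
  then have "energy (f y) + pressure (energy (f y)) = f y * S y"
    unfolding energy_def pressure_def S_powers(1)[OF y]
    by (simp add: divide_simps power2_eq_square) (simp add: algebra_simps)
  moreover have "(\<Sum>\<alpha>\<in>UNIV. (v y $ \<mu> * v y $ \<alpha> + mink $ \<mu> $ \<alpha>) * pd D \<alpha> ?P (\<eta> y))
      = v y $ \<mu> * (\<Sum>\<alpha>\<in>UNIV. v y $ \<alpha> * pd D \<alpha> ?P (\<eta> y)) + (\<Sum>\<alpha>\<in>UNIV. mink $ \<mu> $ \<alpha> * pd D \<alpha> ?P (\<eta> y))"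
    by (simp add: distrib_right sum.distrib sum_distrib_left mult.assoc)
  ultimately have "?lhs = f y * S y * pd \<Omega> 0 (\<lambda>z. v z $ \<mu>) y + v y $ \<mu> * pd \<Omega> 0 (\<lambda>z. ?P (\<eta> z)) y
      + ?g * pd D \<mu> ?P (\<eta> y)"
    using pd_flow_time[OF y P] pd_flow_time[OF y u_differentiable[OF x]] by (simp add: mink_contract)
  also have "\<dots> = f y * (S y * pd \<Omega> 0 (\<lambda>z. v z $ \<mu>) y + v y $ \<mu> * pd \<Omega> 0 S y
      + ?g * (\<Sum>K\<in>UNIV. A y $ K $ \<mu> * pd \<Omega> K S y))"
    unfolding pd_flow_inverse[OF y P] pd_pressure[OF y]
    by (simp add: algebra_simps sum_distrib_left)
  also have "\<dots> = f y * ((?g * ?g) * (S y * pd \<Omega> 0 (\<lambda>z. v z $ \<mu>) y + v y $ \<mu> * pd \<Omega> 0 S y)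
      + ?g * (\<Sum>K\<in>UNIV. A y $ K $ \<mu> * pd \<Omega> K S y))"
    by (simp only: mink_diag_square mult_1)
  also have "\<dots> = ?g * f y * momentum_defect \<mu> y"
    unfolding momentum_defect_def pd_lower[OF y v_differentiable[OF y]] unfolding lower_eq
    by (simp only: algebra_simps)
  finally show ?thesis .
qed

context
  assumes mass: "mass_eq \<Omega> \<eta> F f"
begin

lemma F_eq: "y \<in> \<Omega> \<Longrightarrow> F y = f y * J y"
  using mass by (simp add: mass_eq_def)

lemma pd_F:
  assumes y: "y \<in> \<Omega>"
  shows "pd \<Omega> K F y = pd \<Omega> K f y * J y + f y * pd \<Omega> K J y"
proof -
  have "pd \<Omega> K F y = pd \<Omega> K (\<lambda>z. f z * J z) y"
    by (rule pd_cong[OF y F_eq])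
  then show ?thesis
    by (simp only: pd_mass_density[OF y])
qed

text \<open>
  With \<open>F = f J\<close> the flux \<open>F\<^sup>2 A\<^sup>K\<^sub>\<mu> J\<^sup>-\<^sup>1 S\<close> is the cofactor matrix times the pressure, so by the Piola identity its
  divergence is \<open>J A\<^sup>K\<^sub>\<mu> \<partial>\<^sub>K p\<close>. The last term is the contribution of the time derivative of the pressure,
  rewritten with \<open>f \<partial>\<^sub>\<tau> J = - J \<partial>\<^sub>\<tau> f\<close>, which is \<open>\<partial>\<^sub>\<tau> F = 0\<close>.
\<close>

lemma momentum_residual:
  assumes y: "y \<in> \<Omega>"
  shows "F y * S y * pd \<Omega> 0 (\<lambda>y. lower (v y) \<mu>) y
        + (\<Sum>K\<in>UNIV. pd \<Omega> K (\<lambda>y. (F y)\<^sup>2 * A y $ K $ \<mu> * J y powi (-1) * S y) y)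
        - 2 * (F y)\<^sup>2 * lower (v y) \<mu> * J y powi (-2) * S y powr (3/2) * pd \<Omega> 0 J y
      = F y * momentum_defect \<mu> y"
proof -
  let ?P = "\<lambda>z. pressure (energy (f z))"
  have eq: "(F z)\<^sup>2 * A z $ K $ \<mu> * J z powi (-1) * S z = (J z * A z $ K $ \<mu>) * ?P z" if z: "z \<in> \<Omega>" for z K
    using J_pos[OF z] f_range[OF z] unfolding F_eq[OF z] S_powers(1)[OF z]
    by (simp add: pressure_def energy_def power_int_minus power2_eq_square divide_simps)
  have P: "?P differentiable (at y within \<Omega>)"
    using f_range[OF y] by (intro differentiable_compose_real[OF f_differentiable[OF y] pressure_derivative]) auto
  have JA: "(\<lambda>z. J z * A z $ K $ \<mu>) differentiable (at y within \<Omega>)" for K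
    by (intro differentiable_mult J_differentiable A_differentiable y)
  have "pd \<Omega> K (\<lambda>y. (F y)\<^sup>2 * A y $ K $ \<mu> * J y powi (-1) * S y) y
      = pd \<Omega> K (\<lambda>z. J z * A z $ K $ \<mu>) y * ?P y + J y * A y $ K $ \<mu> * (f y * pd \<Omega> K S y)" for K
    using pd_cong[OF y eq] pd_mult[OF unique_derivs_Omega[OF y] JA P] pd_pressure[OF y] by simp
  then have divergence: "(\<Sum>K\<in>UNIV. pd \<Omega> K (\<lambda>y. (F y)\<^sup>2 * A y $ K $ \<mu> * J y powi (-1) * S y) y)
      = J y * f y * (\<Sum>K\<in>UNIV. A y $ K $ \<mu> * pd \<Omega> K S y)"
    using piola[OF y, of \<mu>]
    by (simp add: sum.distrib flip: sum_distrib_right) (simp add: sum_distrib_left mult_ac)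
  have J_time: "f y * pd \<Omega> 0 J y = - (pd \<Omega> 0 f y * J y)"
    using pd_F[OF y, of 0] pd_F_time[OF y] by simp
  have "2 * (F y)\<^sup>2 * lower (v y) \<mu> * J y powi (-2) * S y powr (3/2) * pd \<Omega> 0 J y
      = 2 * f y * lower (v y) \<mu> / (1 - f y) ^ 3 * (f y * pd \<Omega> 0 J y)"
    using J_pos[OF y] unfolding F_eq[OF y] S_powers(2)[OF y]
    by (simp add: power_int_minus power2_eq_square divide_simps)
  also have "\<dots> = - (f y * J y * lower (v y) \<mu> * pd \<Omega> 0 S y)"
    unfolding J_time pd_S[OF y] by simp
  finally show ?thesis
    unfolding divergence momentum_defect_def F_eq[OF y] by (simp add: algebra_simps)
qed

text \<open>
  Substituting \<open>f = F / J\<close> in the defect and collecting the material derivatives gives, for each index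
  \<open>K\<close>, one and the same term \<open>2 A\<^sup>K\<^sub>\<mu> \<partial>\<^sub>K f\<close>, written with \<open>F\<close> and \<open>J\<close>; the equation merely distributes these
  four terms over its two sides. For \<open>K = 0\<close> the part with \<open>\<partial>\<^sub>0 F\<close> is zero, hence absent there.
\<close>

lemma normal_residual:
  fixes \<mu> :: 4
  defines "\<eta>\<^sub>l \<equiv> (\<lambda>z. lower (\<eta> z) \<mu>)" and "a \<equiv> amat \<Omega> \<eta>" and "J2 \<equiv> (\<lambda>z. J z powi (-2))"
  assumes y: "y \<in> \<Omega>"
  shows "(F y * a y $ 3 $ \<mu> * pd \<Omega> 3 J2 y + 2 * a y $ 3 $ \<mu> * pd \<Omega> 3 F y * J2 y)
      - (- (S y powr (-1/2)) * pd \<Omega> 0 (pd \<Omega> 0 \<eta>\<^sub>l) y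
        + 2 * F y * J2 y * pd \<Omega> 0 J y * pd \<Omega> 0 \<eta>\<^sub>l y
        - F y * a y $ 0 $ \<mu> * pd \<Omega> 0 J2 y
        - F y * (\<Sum>B\<in>{1, 2}. a y $ B $ \<mu> * pd \<Omega> B J2 y)
        - 2 * (\<Sum>B\<in>{1, 2}. a y $ B $ \<mu> * pd \<Omega> B F y) * J2 y)
      = (1 - f y) ^ 3 * momentum_defect \<mu> y" (is "?lhs = _")
proof -
  let ?j = "J y"
  have j: "?j > 0" and r: "1 - f y > 0"
    using J_pos[OF y] f_range[OF y] by auto
  have velocity: "pd \<Omega> 0 \<eta>\<^sub>l z = lower (v z) \<mu>" if z: "z \<in> \<Omega>" for z
  proof -
    have "(\<lambda>z. \<eta> z $ \<mu>) differentiable (at z within \<Omega>)"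
      using bounded_linear.has_derivative[OF bounded_linear_vec_nth eta_has_derivative[OF z]]
      by (rule differentiableI)
    then show ?thesis
      using pd_lower[OF z, of \<eta>] M_time_column[OF z, of \<mu>] by (simp add: \<eta>\<^sub>l_def Mmat_def lower_eq)
  qed
  have "((\<lambda>s. s powi (-2)) has_real_derivative - 2 / ?j ^ 3) (at ?j)"
    using j by (auto intro!: derivative_eq_intros simp: power_int_minus power2_eq_square power3_eq_cube divide_simps)
  from pd_compose_real[OF unique_derivs_Omega[OF y] J_differentiable[OF y] this]
  have J2: "pd \<Omega> K J2 y = - 2 / ?j ^ 3 * pd \<Omega> K J y" for K
    unfolding J2_def .
  define T where "T = (\<lambda>K. F y * a y $ K $ \<mu> * pd \<Omega> K J2 y + 2 * a y $ K $ \<mu> * pd \<Omega> K F y * J2 y)"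
  have T: "T K = 2 * A y $ K $ \<mu> * pd \<Omega> K f y" for K
    using j unfolding T_def J2 pd_F[OF y] F_eq[OF y]
    by (simp add: a_def amat_def J2_def power_int_minus power2_eq_square power3_eq_cube divide_simps)
      (simp add: algebra_simps)
  have J_time: "f y * pd \<Omega> 0 J y = - (pd \<Omega> 0 f y * ?j)"
    using pd_F[OF y, of 0] pd_F_time[OF y] by simp
  have acceleration: "pd \<Omega> 0 (pd \<Omega> 0 \<eta>\<^sub>l) y = pd \<Omega> 0 (\<lambda>z. lower (v z) \<mu>) y"
    by (rule pd_cong[OF y velocity])
  have "2 * F y * J2 y * pd \<Omega> 0 J y = 2 / ?j * (f y * pd \<Omega> 0 J y)"
    using j unfolding F_eq[OF y] by (simp add: J2_def power_int_minus power2_eq_square divide_simps)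
  also have "\<dots> = - 2 * pd \<Omega> 0 f y"
    using j unfolding J_time by simp
  finally have damping: "2 * F y * J2 y * pd \<Omega> 0 J y = - 2 * pd \<Omega> 0 f y" .
  have "?lhs = (\<Sum>K\<in>UNIV. T K) + S y powr (-1/2) * pd \<Omega> 0 (pd \<Omega> 0 \<eta>\<^sub>l) y
      - 2 * F y * J2 y * pd \<Omega> 0 J y * pd \<Omega> 0 \<eta>\<^sub>l y"
    unfolding UNIV_4_zero_based T_def using pd_F_time[OF y] by (simp add: algebra_simps)
  also have "\<dots> = (\<Sum>K\<in>UNIV. 2 * A y $ K $ \<mu> * pd \<Omega> K f y) + (1 - f y) * pd \<Omega> 0 (\<lambda>z. lower (v z) \<mu>) y
      + 2 * pd \<Omega> 0 f y * lower (v y) \<mu>"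
    unfolding T S_powers(3)[OF y] damping velocity[OF y] acceleration by simp
  also have "\<dots> = (1 - f y) ^ 3 * momentum_defect \<mu> y"
    using r unfolding momentum_defect_def pd_S[OF y] S_powers(1)[OF y]
    by (simp add: distrib_left sum_distrib_left power2_eq_square power3_eq_cube)
      (simp add: mult_ac)
  finally show ?thesis .
qed

end

section \<open>Extension across the vacuum\<close>

lemma continuous_on_pd_compose_flow:
  assumes h': "\<And>x. x \<in> D \<Longrightarrow> (h has_derivative h' x) (at x within D)"
    and cont: "\<And>w. continuous_on D (\<lambda>x. h' x w)"
  shows "continuous_on \<Omega> (pd \<Omega> K (\<lambda>z. h (\<eta> z)))"
proof -
  have M: "continuous_on \<Omega> (\<lambda>z. M z $ i $ K)" for i K
    using M_differentiable by (intro differentiable_imp_continuous_on) (simp add: differentiable_on_def)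
  have "continuous_on \<Omega> (\<lambda>z. \<Sum>\<alpha>\<in>UNIV. h' (\<eta> z) (axis \<alpha> 1) * M z $ \<alpha> $ K)"
    using image_in_D
    by (intro continuous_on_sum continuous_on_mult M continuous_on_compose2[OF cont continuous_on_eta]) auto
  then show ?thesis
    by (rule continuous_on_eq) (simp add: pd_compose_flow[OF _ h'] image_in_D)
qed

text \<open>
  Only first derivatives of \<open>n\<close>, \<open>u\<close> and \<open>\<eta>\<close> are involved, by the chain rule for the flow.
\<close>

lemma continuous_on_momentum_defect: "continuous_on \<Omega> (momentum_defect \<mu>)"
proof -
  obtain n' where "\<And>x. x \<in> D \<Longrightarrow> (n has_derivative n' x) (at x within D)"
    "\<And>w. continuous_on D (\<lambda>x. n' x w)"
    using smooth_upto_C1[OF smooth(2)] by metis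
  then have df: "continuous_on \<Omega> (pd \<Omega> K f)" for K
    by (rule continuous_on_pd_compose_flow)
  obtain u' where u': "\<And>x. x \<in> D \<Longrightarrow> (u has_derivative u' x) (at x within D)"
    "\<And>w. continuous_on D (\<lambda>x. u' x w)"
    using smooth_upto_C1[OF smooth(3)] by metis
  have dv: "continuous_on \<Omega> (pd \<Omega> K (\<lambda>z. v z $ \<mu>))" for K
    by (rule continuous_on_pd_compose_flow[where h = "\<lambda>x. u x $ \<mu>", OF u_component_has_derivative[OF u'(1)]])
      (auto intro: continuous_on_component u'(2))
  have cont: "continuous_on \<Omega> f" "continuous_on \<Omega> (\<lambda>z. v z $ \<mu>)" "continuous_on \<Omega> S"
    "\<And>K. continuous_on \<Omega> (\<lambda>z. A z $ K $ \<mu>)"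
    using f_differentiable v_differentiable S_differentiable A_differentiable
    by (auto intro!: differentiable_imp_continuous_on simp: differentiable_on_def)
  have dS: "continuous_on \<Omega> (pd \<Omega> K S)" for K
  proof (rule continuous_on_eq)
    show "continuous_on \<Omega> (\<lambda>z. 2 / (1 - f z) ^ 3 * pd \<Omega> K f z)"
      using f_range by (intro continuous_intros cont df) force
  qed (simp add: pd_S)
  have "continuous_on \<Omega> (\<lambda>z. mink $ \<mu> $ \<mu> * pd \<Omega> 0 (\<lambda>z. v z $ \<mu>) z)"
    by (intro continuous_intros dv)
  then have dlower: "continuous_on \<Omega> (pd \<Omega> 0 (\<lambda>z. lower (v z) \<mu>))"
    by (rule continuous_on_eq) (simp add: pd_lower v_differentiable)
  show ?thesis
    unfolding momentum_defect_def[abs_def] lower_eq[of "v _"]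
    by (intro continuous_intros cont dS dlower[unfolded lower_eq])
qed

text \<open>
  A label \<open>y\<close> at time \<open>y $ 0\<close> is approached, at that same time, by labels with positive initial density,
  where \<open>F > 0\<close> and hence \<open>g = 0\<close>; continuity of \<open>g\<close> does the rest.
\<close>

lemma zero_off_vacuum_imp_zero:
  assumes g: "continuous_on \<Omega> g" and zero: "\<And>y. y \<in> \<Omega> \<Longrightarrow> F y * g y = 0" and y: "y \<in> \<Omega>"
  shows "g y = (0::real)"
proof -
  have "init_pt y \<in> closure {x \<in> D. x $ 0 = 0 \<and> n x > 0}"
    using init_pt_in_material[OF y] material_manifold by simp
  then obtain x where x: "\<And>k. x k \<in> {x \<in> D. x $ 0 = 0 \<and> n x > 0}" and lim: "x \<longlonglongrightarrow> init_pt y"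
    unfolding closure_sequential by blast
  define z where "z = (\<lambda>k. x k + y $ 0 *\<^sub>R axis 0 1)"
  have x_mat: "x k \<in> material" for k
    using x closure_subset material_manifold by blast
  have z: "z k \<in> \<Omega>" for k
    using x_mat[of k] y by (auto simp: z_def lagr_domain_def material_def axis_def)
  have "init_pt (z k) = x k" for k
    using x_mat[of k] by (auto simp: z_def init_pt_def material_def axis_def vec_eq_iff)
  then have "F (z k) > 0" for k
    using x[of k] future_directed[of "x k"] by simp
  then have gz: "g (z k) = 0" for k
    using zero[OF z[of k]] by (metis less_irrefl mult_eq_0_iff)
  have "z \<longlonglongrightarrow> init_pt y + y $ 0 *\<^sub>R axis 0 1"
    unfolding z_def by (intro tendsto_intros lim)
  then have "z \<longlonglongrightarrow> y"
    using time_line_self[of y] by (simp add: time_line_def)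
  then have "(\<lambda>k. g (z k)) \<longlonglongrightarrow> g y"
    using z by (intro continuous_on_tendsto_compose[OF g _ y]) auto
  then show ?thesis
    using gz by (simp add: LIMSEQ_const_iff)
qed

lemma momentum_eq_iff:
  assumes mass: "mass_eq \<Omega> \<eta> F f"
  shows "momentum_eq \<Omega> \<eta> F S v \<mu> \<longleftrightarrow> (\<forall>y\<in>\<Omega>. momentum_defect \<mu> y = 0)"
proof -
  have "momentum_eq \<Omega> \<eta> F S v \<mu> \<longleftrightarrow> (\<forall>y\<in>\<Omega>. F y * momentum_defect \<mu> y = 0)"
    unfolding momentum_eq_def Let_def by (intro ball_cong refl) (simp only: momentum_residual[OF mass])
  then show ?thesis
    using zero_off_vacuum_imp_zero[OF continuous_on_momentum_defect] by auto
qed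

lemma momentum_eq_normal_form_iff:
  assumes mass: "mass_eq \<Omega> \<eta> F f"
  shows "momentum_eq_normal_form \<Omega> \<eta> F S \<mu> \<longleftrightarrow> (\<forall>y\<in>\<Omega>. momentum_defect \<mu> y = 0)"
  unfolding momentum_eq_normal_form_def Let_def
proof (intro ball_cong refl)
  fix y assume y: "y \<in> \<Omega>"
  have "(1 - f y) ^ 3 \<noteq> 0"
    using f_range[OF y] by simp
  then show "(F y * amat \<Omega> \<eta> y $ 3 $ \<mu> * pd \<Omega> 3 (\<lambda>y. J y powi (-2)) y
        + 2 * amat \<Omega> \<eta> y $ 3 $ \<mu> * pd \<Omega> 3 F y * J y powi (-2) =
        - (S y powr (-1/2)) * pd \<Omega> 0 (pd \<Omega> 0 (\<lambda>y. lower (\<eta> y) \<mu>)) y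
        + 2 * F y * J y powi (-2) * pd \<Omega> 0 J y * pd \<Omega> 0 (\<lambda>y. lower (\<eta> y) \<mu>) y
        - F y * amat \<Omega> \<eta> y $ 0 $ \<mu> * pd \<Omega> 0 (\<lambda>y. J y powi (-2)) y
        - F y * (\<Sum>A\<in>{1, 2}. amat \<Omega> \<eta> y $ A $ \<mu> * pd \<Omega> A (\<lambda>y. J y powi (-2)) y)
        - 2 * (\<Sum>A\<in>{1, 2}. amat \<Omega> \<eta> y $ A $ \<mu> * pd \<Omega> A F y) * J y powi (-2))
      \<longleftrightarrow> momentum_defect \<mu> y = 0"
    by (rule eq_iff_of_difference_eq[OF normal_residual[OF mass y, of \<mu>]])
qed

text \<open>
  The normalization determines the square of \<open>v\<^sup>0\<close>, and future-directedness its sign.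
\<close>

lemma normalization_eq_iff: "normalization_eq \<Omega> v \<longleftrightarrow> (\<forall>x\<in>D. mink_prod (u x) (u x) = - 1)"
proof -
  have "v y $ 0 = sqrt (1 + (\<Sum>a\<in>{1, 2, 3}. (v y $ a)\<^sup>2))"
    if y: "y \<in> \<Omega>" and norm: "mink_prod (v y) (v y) = - 1" for y
  proof -
    have diag: "mink $ 0 $ 0 = - 1" "mink $ 1 $ 1 = 1" "mink $ 2 $ 2 = 1" "mink $ 3 $ 3 = 1"
      by (simp_all add: mink_def)
    have "mink_prod w w = (\<Sum>\<alpha>\<in>UNIV. mink $ \<alpha> $ \<alpha> * (w $ \<alpha>)\<^sup>2)" for w
    proof -
      have "mink_prod w w = (\<Sum>\<alpha>\<in>UNIV. w $ \<alpha> * lower w \<alpha>)"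
        unfolding mink_prod_def lower_def sum_distrib_left by (intro sum.cong refl) (simp only: mult_ac)
      then show ?thesis
        by (simp add: lower_eq power2_eq_square mult_ac)
    qed
    then have "(v y $ 0)\<^sup>2 = 1 + (\<Sum>a\<in>{1, 2, 3}. (v y $ a)\<^sup>2)"
      using norm diag unfolding UNIV_4_zero_based by simp
    then show ?thesis
      using real_sqrt_unique[of "v y $ 0"] future_directed[OF image_in_D[OF y]] by simp
  qed
  then have "normalization_eq \<Omega> v \<longleftrightarrow> (\<forall>y\<in>\<Omega>. mink_prod (v y) (v y) = - 1)"
    unfolding normalization_eq_def by blast
  then show ?thesis
    by (simp add: fluid_region_def)
qed

text \<open>
  With mass conserved, \<open>f\<close> and \<open>F = f J\<close> have the same zeros, so both momentum equations amount to the
  vanishing of the momentum defect.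
\<close>

lemma euler_equations_iff:
  "euler_equations D n u \<longleftrightarrow>
     mass_eq \<Omega> \<eta> F f \<and> (\<forall>\<mu>. momentum_eq \<Omega> \<eta> F S v \<mu>) \<and> normalization_eq \<Omega> v"
proof -
  have "euler_equations D n u \<longleftrightarrow>
      mass_eq \<Omega> \<eta> F f \<and> (\<forall>\<mu>. \<forall>y\<in>\<Omega>. f y * momentum_defect \<mu> y = 0) \<and> normalization_eq \<Omega> v"
  proof -
    have "mink $ \<mu> $ \<mu> \<noteq> 0" for \<mu>
      by (simp add: mink_def)
    then have "(\<forall>x\<in>D. \<forall>\<mu>. (energy (n x) + pressure (energy (n x))) * (\<Sum>\<alpha>\<in>UNIV. u x $ \<alpha> * pd D \<alpha> (\<lambda>x. u x $ \<mu>) x)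
        + (\<Sum>\<alpha>\<in>UNIV. (u x $ \<mu> * u x $ \<alpha> + mink $ \<mu> $ \<alpha>) * pd D \<alpha> (\<lambda>x. pressure (energy (n x))) x) = 0)
        \<longleftrightarrow> (\<forall>\<mu>. \<forall>y\<in>\<Omega>. f y * momentum_defect \<mu> y = 0)"
      using euler_momentum_residual by (auto simp: fluid_region_def)
    then show ?thesis
      unfolding euler_equations_def Let_def mass_eq_iff normalization_eq_iff by blast
  qed
  also have "\<dots> \<longleftrightarrow> mass_eq \<Omega> \<eta> F f \<and> (\<forall>\<mu>. \<forall>y\<in>\<Omega>. momentum_defect \<mu> y = 0) \<and> normalization_eq \<Omega> v"
  proof -
    have "momentum_defect \<mu> y = 0"
      if "mass_eq \<Omega> \<eta> F f" "\<forall>\<mu>. \<forall>y\<in>\<Omega>. f y * momentum_defect \<mu> y = 0" "y \<in> \<Omega>" for \<mu> y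
      using that F_eq
      by (intro zero_off_vacuum_imp_zero[OF continuous_on_momentum_defect]) auto
    then show ?thesis
      by auto
  qed
  also have "\<dots> \<longleftrightarrow> mass_eq \<Omega> \<eta> F f \<and> (\<forall>\<mu>. momentum_eq \<Omega> \<eta> F S v \<mu>) \<and> normalization_eq \<Omega> v"
    using momentum_eq_iff by blast
  finally show ?thesis .
qed

end

section \<open>Equivalence of the Eulerian and Lagrangian formulations\<close>

theorem proposition1p1:
  fixes I :: "real set"
    and n :: "R4 \<Rightarrow> real" and u \<eta> :: "R4 \<Rightarrow> R4"
    and \<Omega> D :: "R4 set"
    and f S F :: "R4 \<Rightarrow> real" and v :: "R4 \<Rightarrow> R4"
  assumes interval: "is_interval I" "interior I \<noteq> {}" "0 \<in> I"
    and domains: "\<Omega> = lagr_domain I" "D = fluid_region I \<eta>"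
    and flow: "flow_map I u \<eta>"
    and smooth: "smooth_upto \<Omega> \<eta>" "smooth_upto D n" "smooth_upto D u"
    and periodic: "torus_periodic D n" "torus_periodic D u"
    and n_range: "\<And>x. x \<in> D \<Longrightarrow> 0 \<le> n x \<and> n x < 1/3"
    and future_directed: "\<And>x. x \<in> D \<Longrightarrow> u x $ 0 > 0"
    and material_manifold: "closure {x \<in> D. x $ 0 = 0 \<and> n x > 0} = material"
    and unknowns: "f = (\<lambda>y. n (\<eta> y))" "v = (\<lambda>y. u (\<eta> y))" "S = (\<lambda>y. enthalpy (f y))"
    and F_def: "F = (\<lambda>y. n (init_pt y) * u (init_pt y) $ 0)"
  shows "(euler_equations D n u \<longleftrightarrow>
            mass_eq \<Omega> \<eta> F f \<and> (\<forall>\<mu>. momentum_eq \<Omega> \<eta> F S v \<mu>) \<and> normalization_eq \<Omega> v)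
       \<and> (mass_eq \<Omega> \<eta> F f \<longrightarrow>
            (\<forall>\<mu>. (momentum_eq \<Omega> \<eta> F S v \<mu> \<longleftrightarrow> momentum_eq_Sv_form \<Omega> \<eta> S v \<mu>)
               \<and> (momentum_eq \<Omega> \<eta> F S v \<mu> \<longleftrightarrow> momentum_eq_normal_form \<Omega> \<eta> F S \<mu>)))"
proof -
  interpret fluid_motion I n u \<eta>
    using interval flow smooth n_range future_directed material_manifold
    unfolding domains by unfold_locales auto
  show ?thesis
    unfolding domains unknowns F_def
    using euler_equations_iff momentum_eq_iff momentum_eq_Sv_form_iff momentum_eq_normal_form_iff
    by blast
qed

end
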